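(* Let $q\in(2,6)$ and $\lambda\ge\left(\frac{q+2}{8}\right)^2$. Then the system $$\begin{cases}-\Delta u+u+\lambda\phi|u|^3u=|u|^4u+|u|^{q-2}u, & x\in\mathbb{R}^3,\\ -\Delta\phi=|u|^5, & x\in\mathbb{R}^3,\end{cases}$$ has no nontrivial solution, i.e. the only weak solution $u\in H^1(\mathbb{R}^3)$ (with $\phi=\phi_u\in\mathcal{D}^{1,2}(\mathbb{R}^3)$) is $u=0$.
   Context: $\mathcal{D}^{1,2}(\mathbb{R}^3)=\{u\in L^6(\mathbb{R}^3):|\nabla u|\in L^2(\mathbb{R}^3)\}$. For $u\in H^1(\mathbb{R}^3)$, $\phi_u\in\mathcal{D}^{1,2}(\mathbb{R}^3)$ denotes the unique weak solution of $-\Delta\phi=|u|^5$, given by $\phi_u(x)=\frac1{4\pi}\int_{\mathbb{R}^3}\frac{|u(y)|^5}{|x-y|}\,\mathrm{d}y$. A function $u\in H^1(\mathbb{R}^3)$ is a (weak) solution of the system if for all $v\in H^1(\mathbb{R}^3)$, $$\int_{\mathbb{R}^3}(\nabla u\cdot\nabla v+uv)\,\mathrm{d}x+\lambda\int_{\mathbb{R}^3}\phi_u|u|^3uv\,\mathrm{d}x-\int_{\mathbb{R}^3}|u|^4uv\,\mathrm{d}x-\int_{\mathbb{R}^3}|u|^{q-2}uv\,\mathrm{d}x=0.$$ It is nontrivial if $u\neq0$. *)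

theory Defs
  imports "HOL-Analysis.Analysis"
begin

text \<open>
  Elements of Lebesgue and Sobolev spaces are represented by Lebesgue measurable functions
  rather than by classes of functions modulo null sets; equality in these spaces is therefore
  equality almost everywhere.
\<close>

definition Lp :: "real \<Rightarrow> (real^3 \<Rightarrow> 'b::euclidean_space) \<Rightarrow> bool" where
  "Lp p f \<longleftrightarrow> f \<in> borel_measurable lebesgue \<and> integrable lebesgue (\<lambda>x. norm (f x) powr p)"

definition locally_integrable :: "(real^3 \<Rightarrow> 'b::euclidean_space) \<Rightarrow> bool" where
  "locally_integrable f \<longleftrightarrow> (\<forall>K. compact K \<longrightarrow> f absolutely_integrable_on K)"

definition partial_deriv :: "3 \<Rightarrow> (real^3 \<Rightarrow> real) \<Rightarrow> real^3 \<Rightarrow> real" where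
  "partial_deriv i f x = frechet_derivative f (at x) (axis i 1)"

primrec C_k :: "nat \<Rightarrow> (real^3 \<Rightarrow> real) \<Rightarrow> bool" where
  "C_k 0 f \<longleftrightarrow> continuous_on UNIV f"
| "C_k (Suc k) f \<longleftrightarrow> (\<forall>x. f differentiable (at x)) \<and> (\<forall>i. C_k k (partial_deriv i f))"

definition test_function :: "(real^3 \<Rightarrow> real) \<Rightarrow> bool" where
  "test_function \<psi> \<longleftrightarrow> (\<forall>k. C_k k \<psi>) \<and> compact (closure {x. \<psi> x \<noteq> 0})"

definition has_weak_gradient :: "(real^3 \<Rightarrow> real) \<Rightarrow> (real^3 \<Rightarrow> real^3) \<Rightarrow> bool" where
  "has_weak_gradient u G \<longleftrightarrow> locally_integrable u \<and> locally_integrable G \<and>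
     (\<forall>\<psi> i. test_function \<psi> \<longrightarrow>
        (\<integral>x. u x * partial_deriv i \<psi> x \<partial>lebesgue) = - (\<integral>x. G x $ i * \<psi> x \<partial>lebesgue))"

definition weakly_differentiable :: "(real^3 \<Rightarrow> real) \<Rightarrow> bool" where
  "weakly_differentiable u \<longleftrightarrow> (\<exists>G. has_weak_gradient u G)"

text \<open>
  A weak gradient is unique up to a null set, so the choice of representative
  does not affect any integral below.
\<close>

definition weak_grad :: "(real^3 \<Rightarrow> real) \<Rightarrow> real^3 \<Rightarrow> real^3" where
  "weak_grad u = (SOME G. has_weak_gradient u G)"

definition H1 :: "(real^3 \<Rightarrow> real) set" where
  "H1 = {u. Lp 2 u \<and> weakly_differentiable u \<and> Lp 2 (weak_grad u)}"

definition D12 :: "(real^3 \<Rightarrow> real) set" where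
  "D12 = {u. Lp 6 u \<and> weakly_differentiable u \<and> Lp 2 (weak_grad u)}"

text \<open>
  The weak form of \<open>-\<Delta>\<phi> = f\<close> in \<^term>\<open>D12\<close>, tested against the whole space.
\<close>

definition weak_poisson_solution :: "(real^3 \<Rightarrow> real) \<Rightarrow> (real^3 \<Rightarrow> real) \<Rightarrow> bool" where
  "weak_poisson_solution f \<phi> \<longleftrightarrow> \<phi> \<in> D12 \<and>
     (\<forall>v\<in>D12. (\<integral>x. weak_grad \<phi> x \<bullet> weak_grad v x \<partial>lebesgue) = (\<integral>x. f x * v x \<partial>lebesgue))"

text \<open>
  For \<open>u\<close> in \<^term>\<open>H1\<close> the function \<open>\<phi>\<close> below exists and is unique up to a null set: it is
  \<open>\<phi>\<^sub>u\<close>, the Newtonian potential of \<open>\<bar>u\<bar>\<^sup>5\<close>.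
\<close>

definition weak_solution :: "real \<Rightarrow> real \<Rightarrow> (real^3 \<Rightarrow> real) \<Rightarrow> bool" where
  "weak_solution q lam u \<longleftrightarrow> u \<in> H1 \<and>
     (\<exists>\<phi>. weak_poisson_solution (\<lambda>x. \<bar>u x\<bar> ^ 5) \<phi> \<and>
       (\<forall>v\<in>H1.
          (\<integral>x. weak_grad u x \<bullet> weak_grad v x + u x * v x \<partial>lebesgue)
          + lam * (\<integral>x. \<phi> x * \<bar>u x\<bar> ^ 3 * u x * v x \<partial>lebesgue)
          - (\<integral>x. \<bar>u x\<bar> ^ 4 * u x * v x \<partial>lebesgue)
          - (\<integral>x. \<bar>u x\<bar> powr (q - 2) * u x * v x \<partial>lebesgue) = 0))"

end

theory Submission imports Defs begin

text \<open>
  Let \<open>A\<close>, \<open>B\<close>, \<open>C\<close> and \<open>P\<close> be the integrals of \<open>\<bar>\<nabla>u\<bar>\<^sup>2\<close>, \<open>u\<^sup>2\<close>, \<open>u^6\<close> and \<open>\<bar>\<nabla>\<phi>\<bar>\<^sup>2\<close>. Testing the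
  first equation with \<open>u\<close>, and the Poisson equation with \<open>\<phi>\<close> (which turns \<open>\<integral> \<phi> \<bar>u\<bar>^5\<close> into \<open>P\<close>),
  gives \<open>A + B + lam * P = C + \<integral> \<bar>u\<bar> powr q\<close>. Since \<open>q\<close> lies between \<open>2\<close> and \<open>6\<close>, weighted
  arithmetic-geometric means bound the last integral by \<open>(6 - q)/4 * B + (q - 2)/4 * C\<close>, so the right-hand
  side is at most \<open>(6 - q)/4 * B + (q + 2)/4 * C\<close>.

  The term in \<open>C\<close> is absorbed by the nonlocal term. Testing the Poisson equation with \<open>\<bar>u\<bar>\<close> yields
  \<open>C = \<integral> \<nabla>\<phi> \<bullet> \<nabla>\<bar>u\<bar>\<close>, hence \<open>2 * c * C \<le> c\<^sup>2 * P + A\<close> for every \<open>c \<ge> 0\<close>. With \<open>c = (q + 2)/8\<close> the left-hand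
  side is exactly \<open>(q + 2)/4 * C\<close>, and \<open>c\<^sup>2 \<le> lam\<close> is the hypothesis on \<open>lam\<close>. What remains is
  \<open>B \<le> (6 - q)/4 * B\<close>, which forces \<open>B = 0\<close> because \<open>q > 2\<close>.

  Two facts about Sobolev functions are used: \<open>u\<close> belongs to \<open>L^6\<close> (lemma \<open>H1_imp_L6\<close>), and \<open>\<bar>u\<bar>\<close> may serve
  as a test function with \<open>\<bar>\<nabla>\<bar>u\<bar>\<bar> \<le> \<bar>\<nabla>u\<bar>\<close> (inside lemma \<open>poisson_L6_estimate\<close>). Both are reached through
  mollifications \<open>u\<^sub>n\<close> of \<open>u\<close>. Each \<open>u\<^sub>n\<close> is bounded and continuously differentiable, its gradient is the
  mollified weak gradient, its \<open>L\<^sup>2\<close> norms do not exceed those of \<open>u\<close> and of the weak gradient of \<open>u\<close>,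
  and \<open>u\<^sub>n\<close> tends to \<open>u\<close> almost everywhere. By Fatou's lemma, inequalities that
  hold uniformly in \<open>n\<close> pass to the limit under almost everywhere convergence. For the first fact the uniform
  inequality is Gagliardo's: in each of the three coordinate directions \<open>\<bar>u\<^sub>n\<bar>^4\<close> is at most a line integral,
  of the size of its derivative plus \<open>u\<^sub>n\<^sup>2\<close>, and the Loomis-Whitney inequality combines the three bounds
  (\<open>sobolev_bound\<close>). For the second fact the modulus is replaced by the smooth function \<open>sqrt (u\<^sub>n\<^sup>2 + \<delta>\<^sub>n\<^sup>2) - \<delta>\<^sub>n\<close>, which lies in \<open>D12\<close>.

  The chosen weak gradient is an arbitrary one, so it can be computed only after weak gradients have been
  shown to be unique almost everywhere (\<open>weak_gradient_unique\<close>); this again follows by mollification.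
\<close>

section \<open>Smooth functions of one real variable\<close>

text \<open>
  One-variable counterpart of \<^const>\<open>C_k\<close>. Naming a derivative by an existential quantifier makes the
  closure properties below plain inductions on the order.
\<close>

primrec smooth_upto :: "nat \<Rightarrow> (real \<Rightarrow> real) \<Rightarrow> bool" where
  "smooth_upto 0 f \<longleftrightarrow> continuous_on UNIV f"
| "smooth_upto (Suc n) f \<longleftrightarrow>
     (\<exists>f'. (\<forall>t. (f has_real_derivative f' t) (at t)) \<and> smooth_upto n f')"

lemma smooth_upto_Suc_imp: "smooth_upto (Suc n) f \<Longrightarrow> smooth_upto n f"
proof (induction n arbitrary: f)
  case 0
  then obtain f' where "\<And>t. (f has_real_derivative f' t) (at t)" by auto
  then show ?case
    using DERIV_isCont by (auto intro!: continuous_at_imp_continuous_on)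
qed (metis smooth_upto.simps(2))

lemma smooth_upto_const: "smooth_upto n (\<lambda>_. c)"
  by (induction n arbitrary: c) (auto intro!: exI[of _ "\<lambda>_. 0"])

lemma smooth_upto_add:
  "smooth_upto n f \<Longrightarrow> smooth_upto n g \<Longrightarrow> smooth_upto n (\<lambda>t. f t + g t)"
proof (induction n arbitrary: f g)
  case 0
  then show ?case by (auto intro: continuous_intros)
next
  case (Suc n)
  then obtain f' g' where "\<forall>t. (f has_real_derivative f' t) (at t)" "smooth_upto n f'"
    "\<forall>t. (g has_real_derivative g' t) (at t)" "smooth_upto n g'" by auto
  then show ?case
    using Suc.IH by (auto intro!: exI[of _ "\<lambda>t. f' t + g' t"] derivative_eq_intros)
qed

lemma smooth_upto_mult:
  "smooth_upto n f \<Longrightarrow> smooth_upto n g \<Longrightarrow> smooth_upto n (\<lambda>t. f t * g t)"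
proof (induction n arbitrary: f g)
  case 0
  then show ?case by (auto intro: continuous_intros)
next
  case (Suc n)
  then obtain f' g' where *: "\<forall>t. (f has_real_derivative f' t) (at t)" "smooth_upto n f'"
    "\<forall>t. (g has_real_derivative g' t) (at t)" "smooth_upto n g'" by auto
  have "smooth_upto n (\<lambda>t. f t * g' t + f' t * g t)"
    using Suc smooth_upto_Suc_imp[OF Suc.prems(1)] smooth_upto_Suc_imp[OF Suc.prems(2)] *
    by (intro smooth_upto_add) blast+
  then show ?case
    using * by (auto intro!: exI[of _ "\<lambda>t. f t * g' t + f' t * g t"] derivative_eq_intros)
qed

lemma smooth_upto_affine: "smooth_upto n f \<Longrightarrow> smooth_upto n (\<lambda>t. f (a + c * t))"
proof (induction n arbitrary: f)
  case 0
  then show ?case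
    by (auto intro!: continuous_on_compose2[of UNIV f] continuous_intros)
next
  case (Suc n)
  then obtain f' where *: "\<forall>t. (f has_real_derivative f' t) (at t)" "smooth_upto n f'" by auto
  have "((\<lambda>t. f (a + c * t)) has_real_derivative c * f' (a + c * t)) (at t)" for t
  proof -
    have "((\<lambda>t. a + c * t) has_real_derivative c) (at t)"
      by (auto intro!: derivative_eq_intros)
    from DERIV_chain2[OF *(1)[rule_format] this] show ?thesis by (simp only: mult.commute)
  qed
  moreover have "smooth_upto n (\<lambda>t. c * f' (a + c * t))"
    using smooth_upto_mult[OF smooth_upto_const Suc.IH[OF *(2)]] .
  ultimately show ?case by (auto intro!: exI[of _ "\<lambda>t. c * f' (a + c * t)"])
qed

text \<open>
  For \<open>p = 1\<close> this is the classical smooth function that vanishes to infinite order at \<open>0\<close>. The polynomial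
  factor is there because the derivative of a function of this form is again of this form.
\<close>

definition flat :: "real poly \<Rightarrow> real \<Rightarrow> real" where
  "flat p t = (if 0 < t then poly p (1 / t) * exp (- (1 / t)) else 0)"

text \<open>
  The exponential beats every power of \<open>x\<close>; with \<open>x = 1 / t\<close> this controls \<^const>\<open>flat\<close> near \<open>0\<close>.
\<close>

lemma poly_exp_tendsto_0: "((\<lambda>x. poly p x * exp (- x)) \<longlongrightarrow> (0::real)) at_top"
proof -
  have "((\<lambda>x. \<Sum>i\<le>degree p. coeff p i * (x ^ i / exp x)) \<longlongrightarrow> (\<Sum>i\<le>degree p. coeff p i * 0)) at_top"
    by (intro tendsto_intros tendsto_power_div_exp_0)
  then show ?thesis
    by (simp add: poly_altdef sum_distrib_right exp_minus divide_inverse mult.assoc)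
qed

lemma flat_tendsto_0: "(flat p \<longlongrightarrow> 0) (at 0)"
proof -
  have "((\<lambda>t. poly p (inverse t) * exp (- inverse t)) \<longlongrightarrow> 0) (at_right 0)"
    using filterlim_compose[OF poly_exp_tendsto_0 filterlim_inverse_at_top_right] by simp
  then have "(flat p \<longlongrightarrow> 0) (at_right 0)"
    by (rule tendsto_cong[THEN iffD1, rotated])
      (auto simp: flat_def eventually_at_filter inverse_eq_divide)
  moreover have "(flat p \<longlongrightarrow> 0) (at_left 0)"
    by (rule tendsto_eventually) (auto simp: flat_def eventually_at_filter)
  ultimately show ?thesis by (simp add: filterlim_at_split)
qed

text \<open>
  For \<open>t > 0\<close> this is the chain rule, with \<open>x = 1 / t\<close> and \<open>dx/dt = - x\<^sup>2\<close>. At \<open>0\<close> the difference quotient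
  of \<open>flat p\<close> is \<open>flat (pCons 0 p)\<close>, since \<open>1 / t\<close> times \<open>p\<close> is the polynomial \<open>x * p x\<close>, and this tends to \<open>0\<close>.
\<close>

lemma flat_has_derivative:
  "(flat p has_real_derivative flat (monom 1 2 * (p - pderiv p)) t) (at t)"
proof (cases t "0::real" rule: linorder_cases)
  case less
  have "((\<lambda>_. 0) has_real_derivative 0) (at t)" by simp
  then have "(flat p has_real_derivative 0) (at t)"
    by (rule has_field_derivative_transform_within_open[of _ _ _ "{..<0}"])
      (use less in \<open>auto simp: flat_def\<close>)
  then show ?thesis using less by (simp add: flat_def)
next
  case equal
  have "((\<lambda>t. (flat p t - flat p 0) / (t - 0)) \<longlongrightarrow> 0) (at 0)"
    using flat_tendsto_0[of "pCons 0 p"]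
    by (rule tendsto_cong[THEN iffD1, rotated]) (auto simp: flat_def eventually_at_filter)
  then show ?thesis using equal
    by (simp add: has_field_derivative_iff flat_def)
next
  case greater
  have "((\<lambda>t. poly p (1 / t) * exp (- (1 / t))) has_real_derivative
      flat (monom 1 2 * (p - pderiv p)) t) (at t)"
    using greater
    by (auto intro!: derivative_eq_intros simp: flat_def poly_monom power2_eq_square field_simps)
  then show ?thesis
    by (rule has_field_derivative_transform_within_open[of _ _ _ "{0<..}"])
      (use greater in \<open>auto simp: flat_def\<close>)
qed

lemma smooth_upto_flat: "smooth_upto n (flat p)"
proof (induction n arbitrary: p)
  case 0
  then show ?case
    by (auto intro!: continuous_at_imp_continuous_on DERIV_isCont flat_has_derivative)
qed (auto intro: flat_has_derivative)

definition bump :: "real \<Rightarrow> real" where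
  "bump t = flat 1 t * flat 1 (1 - t)"

lemma smooth_upto_bump: "smooth_upto n bump"
  using smooth_upto_mult[OF smooth_upto_flat[of n 1] smooth_upto_affine[OF smooth_upto_flat[of n 1], of 1 "-1"]]
  by (simp add: bump_def[abs_def])

lemma bump_nonneg: "0 \<le> bump t" and bump_le_1: "bump t \<le> 1"
  and bump_pos: "0 < t \<Longrightarrow> t < 1 \<Longrightarrow> 0 < bump t"
  and bump_outside: "t \<notin> {0..1} \<Longrightarrow> bump t = 0"
  by (auto simp: bump_def flat_def intro!: mult_le_one)

text \<open>
  The partial derivative in direction \<open>i\<close> replaces the \<open>i\<close>-th factor by its derivative, so it is again a
  product of functions of single coordinates. This is what makes the induction in the next lemma work.
\<close>

lemma has_derivative_prod_coordinates:
  fixes f f' :: "3 \<Rightarrow> real \<Rightarrow> real"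
  assumes "\<And>j t. (f j has_real_derivative f' j t) (at t)"
  shows "((\<lambda>z. \<Prod>j\<in>UNIV. f j (z $ j)) has_derivative
     (\<lambda>v. \<Sum>i\<in>UNIV. v $ i * (\<Prod>j\<in>UNIV. (f(i := f' i)) j (z $ j)))) (at z)"
proof -
  have *: "((\<lambda>z. f j (z $ j)) has_derivative (\<lambda>v. v $ j * f' j (z $ j))) (at z)" for j
    using has_derivative_compose[OF bounded_linear_imp_has_derivative[OF bounded_linear_vec_nth]
        assms[unfolded has_field_derivative_def]]
    by (simp add: mult.commute)
  have "(\<Prod>j\<in>UNIV. (f(i := f' i)) j (z $ j)) = f' i (z $ i) * (\<Prod>j\<in>UNIV - {i}. f j (z $ j))" for i
    by (subst prod.remove[of _ i]) (auto intro!: prod.cong)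
  then show ?thesis
    using has_derivative_prod[of UNIV "\<lambda>j z. f j (z $ j)", OF *]
    by (simp add: mult.assoc)
qed

section \<open>Products of one-variable functions in three variables\<close>

lemma sum_axis: "(\<Sum>j\<in>UNIV. axis i (1::real) $ j * c j) = c i"
  for c :: "'a::finite \<Rightarrow> real"
proof -
  have "axis i (1::real) $ j * c j = (if j = i then c j else 0)" for j
    by (simp add: axis_def)
  then show ?thesis by simp
qed

lemma C_k_prod_coordinates:
  assumes "\<And>j. smooth_upto k (f j)"
  shows "C_k k (\<lambda>z. \<Prod>j\<in>UNIV. f j (z $ j))"
  using assms
proof (induction k arbitrary: f)
  case 0
  then show ?case
    by (simp, intro continuous_on_prod)
      (rule continuous_on_compose2[of UNIV "f _"], simp, rule continuous_on_component[OF continuous_on_id], simp)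
next
  case (Suc k)
  then have "\<forall>j. \<exists>f'. (\<forall>t. (f j has_real_derivative f' t) (at t)) \<and> smooth_upto k f'" by simp
  then obtain f' where f': "\<And>j t. (f j has_real_derivative f' j t) (at t)"
    "\<And>j. smooth_upto k (f' j)" by metis
  note D = has_derivative_prod_coordinates[of f f', OF f'(1)]
  have "partial_deriv i (\<lambda>z. \<Prod>j\<in>UNIV. f j (z $ j)) =
      (\<lambda>z. \<Prod>j\<in>UNIV. (f(i := f' i)) j (z $ j))" for i
    unfolding partial_deriv_def frechet_derivative_at[OF D, symmetric]
    by (rule ext) (rule sum_axis)
  moreover have "smooth_upto k ((f(i := f' i)) j)" for i j
    using f'(2) smooth_upto_Suc_imp[OF Suc.prems, of j] by (cases "j = i") auto
  then have "C_k k (\<lambda>z. \<Prod>j\<in>UNIV. (f(i := f' i)) j (z $ j))" for i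
    by (rule Suc.IH)
  moreover have "\<forall>z. (\<lambda>z. \<Prod>j\<in>UNIV. f j (z $ j)) differentiable (at z)"
    by (intro allI differentiableI, rule D)
  ultimately show ?case by (simp del: fun_upd_apply)
qed

lemma has_derivative_translate:
  fixes f :: "real^3 \<Rightarrow> real"
  assumes "\<And>z. f differentiable (at z)"
  shows "((\<lambda>y. f (y - x)) has_derivative frechet_derivative f (at (y - x))) (at y)"
proof -
  have "((\<lambda>y. y - x) has_derivative (\<lambda>v. v)) (at y)" by (auto intro!: derivative_eq_intros)
  from has_derivative_compose[OF this frechet_derivative_works[THEN iffD1, OF assms]]
  show ?thesis .
qed

lemma partial_deriv_translate:
  assumes "\<And>z. f differentiable (at z)"
  shows "partial_deriv i (\<lambda>y. f (y - x)) = (\<lambda>y. partial_deriv i f (y - x))"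
proof
  show "partial_deriv i (\<lambda>y. f (y - x)) y = partial_deriv i f (y - x)" for y
    unfolding partial_deriv_def
      frechet_derivative_at[OF has_derivative_translate[OF assms], symmetric] ..
qed

lemma C_k_translate: "C_k k f \<Longrightarrow> C_k k (\<lambda>y. f (y - x))"
proof (induction k arbitrary: f)
  case 0
  have "continuous_on UNIV (\<lambda>y. y - x)" by (intro continuous_intros)
  then show ?case using 0 continuous_on_compose2[of UNIV f UNIV "\<lambda>y. y - x"] by simp
next
  case (Suc k)
  then have f: "\<And>z. f differentiable (at z)" by simp
  have "\<forall>z. (\<lambda>y. f (y - x)) differentiable (at z)"
    by (intro allI differentiableI, rule has_derivative_translate[OF f])
  moreover have "C_k k (partial_deriv i (\<lambda>y. f (y - x)))" for i
    unfolding partial_deriv_translate[OF f] using Suc.prems by (intro Suc.IH) simp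
  ultimately show ?case by simp
qed

section \<open>Mollifiers\<close>

lemma sum_Basis_nth [simp]: "(\<Sum>b\<in>Basis. (b :: real^3) $ i) = 1"
proof -
  have "(\<Sum>b\<in>Basis. (b :: real^3) $ i) = (\<Sum>Basis :: real^3) \<bullet> axis i 1"
    by (simp add: inner_axis)
  also have "\<dots> = 1" by simp
  finally show ?thesis .
qed

definition bump3 :: "real^3 \<Rightarrow> real" where
  "bump3 z = (\<Prod>i\<in>UNIV. bump (z $ i))"

text \<open>
  The support lies in the cube with corners \<open>0\<close> and \<open>h *\<^sub>R One\<close>, rather than in a ball around \<open>0\<close>,
  because the Lebesgue differentiation theorem is applied to cubes that have \<open>x\<close> as their lower corner.
\<close>

definition mollifier :: "real \<Rightarrow> real^3 \<Rightarrow> real" where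
  "mollifier h z = bump3 (z /\<^sub>R h) / (h ^ 3 * (\<integral>w. bump3 w \<partial>lborel))"

lemma bump3_nonneg: "0 \<le> bump3 z" and bump3_le_1: "bump3 z \<le> 1"
  by (auto simp: bump3_def bump_nonneg bump_le_1 intro!: prod_nonneg prod_le_1)

lemma bump3_outside:
  assumes "z \<notin> cbox 0 One" shows "bump3 z = 0"
proof -
  obtain i where "z $ i \<notin> {0..1}" using assms by (auto simp: mem_box_cart)
  then show ?thesis unfolding bump3_def using bump_outside by (intro prod_zero) auto
qed

lemma continuous_bump3: "continuous_on UNIV bump3"
  using C_k_prod_coordinates[of 0 "\<lambda>_. bump"] smooth_upto_bump[of 0]
  by (simp add: bump3_def[abs_def])

lemma bump3_integrable: "integrable lborel bump3"
proof -
  have "integrable lborel (\<lambda>x. indicator (cbox 0 One) x *\<^sub>R bump3 x)"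
    by (rule borel_integrable_compact) (auto intro: continuous_on_subset[OF continuous_bump3])
  moreover have "(\<lambda>x. indicator (cbox 0 One) x *\<^sub>R bump3 x) = bump3"
  proof
    show "indicator (cbox 0 One) x *\<^sub>R bump3 x = bump3 x" for x
      using bump3_outside[of x] by (cases "x \<in> cbox 0 One") auto
  qed
  ultimately show ?thesis by simp
qed

text \<open>
  A nonnegative function with vanishing integral is zero almost everywhere, but the bump is positive on the
  open unit cube, which has measure one.
\<close>

lemma bump3_mass_pos: "0 < (\<integral>w. bump3 w \<partial>lborel)"
proof -
  have "(\<integral>w. bump3 w \<partial>lborel) \<noteq> 0"
  proof
    assume "(\<integral>w. bump3 w \<partial>lborel) = 0"
    then have "AE w in lborel. bump3 w = 0"
      using integral_nonneg_eq_0_iff_AE[OF bump3_integrable] bump3_nonneg by simp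
    moreover have "bump3 w \<noteq> 0" if "w \<in> box 0 One" for w
    proof -
      have "0 < bump (w $ i)" for i using that by (intro bump_pos) (auto simp: mem_box_cart)
      then show ?thesis unfolding bump3_def by (simp add: prod_pos less_imp_neq[symmetric])
    qed
    ultimately have "AE w in lborel. w \<notin> box 0 (One :: real^3)" by (elim eventually_mono) blast
    then have "emeasure lborel (box 0 (One :: real^3)) = 0"
      using AE_iff_null_sets[where N = "box 0 (One :: real^3)" and M = lborel]
      by (simp add: null_sets_def)
    moreover have "emeasure lborel (box 0 (One :: real^3)) = ennreal (\<Prod>b\<in>Basis. (One - 0) \<bullet> (b :: real^3))"
      by (rule emeasure_lborel_box) simp
    ultimately show False by simp
  qed
  moreover have "0 \<le> (\<integral>w. bump3 w \<partial>lborel)"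
    by (rule Bochner_Integration.integral_nonneg) (rule bump3_nonneg)
  ultimately show ?thesis by linarith
qed

lemma mollifier_nonneg: "0 < h \<Longrightarrow> 0 \<le> mollifier h z"
  using bump3_mass_pos by (simp add: mollifier_def bump3_nonneg)

lemma mollifier_le:
  "0 < h \<Longrightarrow> mollifier h z \<le> 1 / (h ^ 3 * (\<integral>w. bump3 w \<partial>lborel))"
  using bump3_mass_pos by (simp add: mollifier_def divide_right_mono bump3_le_1)

lemma mollifier_outside:
  assumes "0 < h" "z \<notin> cbox 0 (h *\<^sub>R One)" shows "mollifier h z = 0"
proof -
  have "z /\<^sub>R h \<notin> cbox 0 One"
    using assms by (auto simp: mem_box_cart divide_simps)
  then show ?thesis by (simp add: mollifier_def bump3_outside)
qed

lemma continuous_mollifier: "0 < h \<Longrightarrow> continuous_on UNIV (mollifier h)"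
  unfolding mollifier_def[abs_def] using bump3_mass_pos
  by (auto intro!: continuous_on_divide continuous_on_const
      continuous_on_compose2[OF continuous_bump3] continuous_on_scaleR continuous_on_id)

text \<open>
  Scaling by \<open>h\<close> multiplies Lebesgue measure on three-space by \<open>h ^ 3\<close>.
\<close>

lemma mollifier_integral:
  assumes "0 < h" shows "(\<integral>z. mollifier h z \<partial>lborel) = 1"
proof -
  have [measurable]: "bump3 \<in> borel_measurable borel"
    using continuous_bump3 by (rule borel_measurable_continuous_onI)
  have "(\<integral>z. bump3 (z /\<^sub>R h) \<partial>lborel) =
     (\<integral>z. bump3 (z /\<^sub>R h) \<partial>density (distr lborel borel (\<lambda>x. 0 + h *\<^sub>R x)) (\<lambda>_. ennreal (\<bar>h\<bar> ^ 3)))"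
    using arg_cong[OF lborel_affine[of h "0::real^3"], of "\<lambda>M. integral\<^sup>L M (\<lambda>z. bump3 (z /\<^sub>R h))"] assms
    by simp
  also have "\<dots> = (\<integral>z. h ^ 3 * bump3 z \<partial>lborel)"
    using assms by (subst integral_density) (auto simp: integral_distr)
  finally show ?thesis using assms bump3_mass_pos by (simp add: mollifier_def)
qed

text \<open>
  The mollifier is a product of functions of single coordinates once its normalising constant is moved
  into the factor for the first coordinate.
\<close>

lemma test_function_mollifier:
  assumes "0 < h" shows "test_function (mollifier h)"
  unfolding test_function_def
proof (intro conjI allI)
  define c where "c = 1 / (h ^ 3 * (\<integral>w. bump3 w \<partial>lborel))"
  define f where "f j t = (if j = 1 then c else 1) * bump (0 + (1 / h) * t)" for j :: 3 and t
  have "smooth_upto k (f j)" for k j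
    unfolding f_def[abs_def]
    by (intro smooth_upto_mult smooth_upto_const smooth_upto_affine smooth_upto_bump)
  moreover have "(\<lambda>z. \<Prod>j\<in>UNIV. f j (z $ j)) = mollifier h"
    by (auto simp: f_def mollifier_def c_def prod.distrib bump3_def divide_inverse mult_ac)
  ultimately show "C_k k (mollifier h)" for k
    using C_k_prod_coordinates[of k f] by simp
  have "{x. mollifier h x \<noteq> 0} \<subseteq> cbox 0 (h *\<^sub>R One)"
    using mollifier_outside[OF assms] by auto
  then show "compact (closure {x. mollifier h x \<noteq> 0})"
    unfolding compact_closure by (rule bounded_subset[OF bounded_cbox])
qed

section \<open>Test functions\<close>

lemma test_function_translate:
  assumes "test_function \<psi>" shows "test_function (\<lambda>y. \<psi> (y - x))"
proof -
  have "{y. \<psi> (y - x) \<noteq> 0} = (\<lambda>z. x + z) ` {z. \<psi> z \<noteq> 0}"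
    by (auto simp: image_iff intro!: exI[of _ "_ - x"])
  then show ?thesis
    using assms C_k_translate by (auto simp: test_function_def compact_closure bounded_translation)
qed

lemma test_function_differentiable: "test_function \<psi> \<Longrightarrow> \<psi> differentiable (at x)"
  and test_function_continuous_partial: "test_function \<psi> \<Longrightarrow> continuous_on UNIV (partial_deriv i \<psi>)"
  using C_k.simps(2)[of 0 \<psi>] unfolding test_function_def C_k.simps(1)
  by blast+

lemma test_function_continuous: "test_function \<psi> \<Longrightarrow> continuous_on UNIV \<psi>"
  unfolding test_function_def by (metis C_k.simps(1))

lemma test_function_line_derivative:
  assumes "test_function \<psi>"
  shows "((\<lambda>t. \<psi> (x + t *\<^sub>R axis i 1)) has_real_derivative partial_deriv i \<psi> (x + t *\<^sub>R axis i 1)) (at t)"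
proof -
  let ?D = "frechet_derivative \<psi> (at (x + t *\<^sub>R axis i 1))"
  have D: "(\<psi> has_derivative ?D) (at (x + t *\<^sub>R axis i 1))"
    using test_function_differentiable[OF assms] by (rule frechet_derivative_works[THEN iffD1])
  have "((\<lambda>t. x + t *\<^sub>R axis i 1) has_derivative (\<lambda>s. s *\<^sub>R axis i 1)) (at t)"
    by (auto intro!: derivative_eq_intros)
  from has_derivative_compose[OF this D] show ?thesis
    unfolding has_field_derivative_def partial_deriv_def
    by (simp add: linear_cmul[OF has_derivative_linear[OF D]] mult_commute_abs)
qed

text \<open>
  A test function and its first derivatives are continuous and vanish off one common ball, so one radius
  and one bound serve for all of them.
\<close>

lemma test_function_bounds:
  assumes "test_function \<psi>"
  obtains r B where "\<And>x. \<psi> x \<noteq> 0 \<Longrightarrow> norm x \<le> r" "\<And>x i. partial_deriv i \<psi> x \<noteq> 0 \<Longrightarrow> norm x \<le> r"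
    "\<And>x. \<bar>\<psi> x\<bar> \<le> B" "\<And>x i. \<bar>partial_deriv i \<psi> x\<bar> \<le> B"
proof -
  obtain r where r: "\<And>x. \<psi> x \<noteq> 0 \<Longrightarrow> norm x \<le> r"
    using assms by (auto simp: test_function_def compact_closure bounded_iff)
  have z: "partial_deriv i \<psi> x = 0" if "r < norm x" for i x
  proof -
    have "((\<lambda>_. 0) has_derivative (\<lambda>_. 0)) (at x)" by simp
    then have "(\<psi> has_derivative (\<lambda>_. 0)) (at x)"
      by (rule has_derivative_transform_within_open[of _ _ _ _ "- cball 0 r"])
        (use r that in fastforce)+
    from frechet_derivative_at[OF this] show ?thesis
      unfolding partial_deriv_def by metis
  qed
  have "\<exists>B. \<forall>x. \<bar>f x\<bar> \<le> B" if c: "continuous_on UNIV f" and f: "\<And>x. r < norm x \<Longrightarrow> f x = 0"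
    for f :: "real^3 \<Rightarrow> real"
  proof -
    have "bounded (f ` cball 0 r)"
      by (intro compact_imp_bounded compact_continuous_image continuous_on_subset[OF c]) auto
    then obtain B where "\<forall>y\<in>f ` cball 0 r. norm y \<le> B"
      unfolding bounded_iff by blast
    then have "\<bar>f x\<bar> \<le> B" if "norm x \<le> r" for x using that by auto
    then have "\<bar>f x\<bar> \<le> max B 0" for x using f[of x] by (cases "norm x \<le> r") force+
    then show ?thesis by blast
  qed
  note b = this
  obtain B0 where B0: "\<And>x. \<bar>\<psi> x\<bar> \<le> B0"
    using b[OF test_function_continuous[OF assms]] r by force
  have "\<forall>i. \<exists>B. \<forall>x. \<bar>partial_deriv i \<psi> x\<bar> \<le> B"
    using b[OF test_function_continuous_partial[OF assms]] z by blast
  then obtain B1 where B1: "\<And>i x. \<bar>partial_deriv i \<psi> x\<bar> \<le> B1 i" by metis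
  have S: "0 \<le> (\<Sum>i\<in>UNIV. \<bar>B1 i\<bar>)" by (rule sum_nonneg) simp
  have "\<bar>partial_deriv i \<psi> x\<bar> \<le> \<bar>B0\<bar> + (\<Sum>i\<in>UNIV. \<bar>B1 i\<bar>)" for i x
    using B1[of i x] member_le_sum[of i UNIV "\<lambda>i. \<bar>B1 i\<bar>"] abs_ge_zero[of B0] by simp
  moreover have "\<bar>\<psi> x\<bar> \<le> \<bar>B0\<bar> + (\<Sum>i\<in>UNIV. \<bar>B1 i\<bar>)" for x
    using B0[of x] S by linarith
  ultimately show ?thesis using that[of r] r z by (metis not_le)
qed

section \<open>Correlation with a test function\<close>

text \<open>
  This is the convolution of \<open>u\<close> with the reflected kernel \<open>\<lambda>z. \<psi> (- z)\<close>. In this form the kernel,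
  as a function of \<open>y\<close>, is a mere translate of \<open>\<psi>\<close>: it is a test function along with \<open>\<psi>\<close>, and it vanishes for \<open>y\<close> outside
  the translate by \<open>x\<close> of the support of \<open>\<psi>\<close>.
\<close>

definition correlate :: "(real^3 \<Rightarrow> real) \<Rightarrow> (real^3 \<Rightarrow> real) \<Rightarrow> real^3 \<Rightarrow> real" where
  "correlate \<psi> u x = (\<integral>y. \<psi> (y - x) * u y \<partial>lebesgue)"

lemma locally_integrable_cball:
  assumes "locally_integrable u"
  shows "integrable lebesgue (\<lambda>y. indicator (cball 0 R) y *\<^sub>R u y)"
  using assms[unfolded locally_integrable_def set_integrable_def, rule_format, OF compact_cball] .

lemma borel_imp_lebesgue_measurable:
  "f \<in> borel_measurable borel \<Longrightarrow> f \<in> borel_measurable lebesgue"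
  by (intro measurable_completion) simp

text \<open>
  Dominated convergence against a function that is merely locally integrable: the kernels share a bounded
  support, so a multiple of \<open>u\<close> restricted to a ball dominates all integrands.
\<close>

lemma integral_kernel_tendsto:
  fixes u :: "real^3 \<Rightarrow> real"
  assumes u: "locally_integrable u"
    and k: "\<And>n. continuous_on UNIV (k n)" "\<And>n y. \<bar>k n y\<bar> \<le> B" "\<And>n y. R < norm y \<Longrightarrow> k n y = 0"
    and lim: "\<And>y. (\<lambda>n. k n y) \<longlonglongrightarrow> k' y"
  shows "(\<lambda>n. \<integral>y. k n y * u y \<partial>lebesgue) \<longlonglongrightarrow> (\<integral>y. k' y * u y \<partial>lebesgue)"
    and "integrable lebesgue (\<lambda>y. k' y * u y)"
proof -
  define v where "v = (\<lambda>y. indicator (cball 0 R) y *\<^sub>R u y)"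
  have v: "integrable lebesgue v"
    unfolding v_def using u by (rule locally_integrable_cball)
  have [measurable]: "v \<in> borel_measurable lebesgue"
    using v by (rule borel_measurable_integrable)
  have [measurable]: "k n \<in> borel_measurable lebesgue" for n
    using borel_measurable_continuous_onI[OF k(1)[of n]] by (rule borel_imp_lebesgue_measurable)
  have eq: "k n y * u y = k n y * v y" for n y
    using k(3)[of y n] by (auto simp: v_def indicator_def)
  have "k' y = 0" if "R < norm y" for y
    using lim[of y] k(3)[OF that] by (auto intro: LIMSEQ_unique)
  then have eq': "k' y * u y = k' y * v y" for y
    by (auto simp: v_def indicator_def)
  have [measurable]: "k' \<in> borel_measurable lebesgue"
    by (rule borel_measurable_LIMSEQ_metric[OF _ lim]) measurable
  have i: "integrable lebesgue (\<lambda>y. B * norm (v y))"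
    using v by (intro integrable_mult_right integrable_norm)
  have b: "norm (k n y * v y) \<le> B * norm (v y)" for n y
    unfolding norm_mult using k(2)[of n y] by (intro mult_right_mono) simp_all
  have [measurable]: "(\<lambda>y. k' y * v y) \<in> borel_measurable lebesgue"
    "(\<lambda>y. k n y * v y) \<in> borel_measurable lebesgue" for n
    by measurable
  have l: "(\<lambda>n. k n y * v y) \<longlonglongrightarrow> k' y * v y" for y
    by (intro tendsto_intros lim)
  show "(\<lambda>n. \<integral>y. k n y * u y \<partial>lebesgue) \<longlonglongrightarrow> (\<integral>y. k' y * u y \<partial>lebesgue)"
    unfolding eq eq' by (rule integral_dominated_convergence[OF _ _ i]) (use b l in auto)
  show "integrable lebesgue (\<lambda>y. k' y * u y)"
    unfolding eq' by (rule integrable_dominated_convergence[where s = "\<lambda>n y. k n y * v y", OF _ _ i]) (use b l in auto)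
qed

lemma correlate_integrable:
  assumes "test_function \<psi>" "locally_integrable u"
  shows "integrable lebesgue (\<lambda>y. \<psi> (y - x) * u y)"
proof -
  have t: "test_function (\<lambda>y. \<psi> (y - x))" by (rule test_function_translate) fact
  obtain r B where "\<And>y. \<psi> (y - x) \<noteq> 0 \<Longrightarrow> norm y \<le> r" "\<And>y. \<bar>\<psi> (y - x)\<bar> \<le> B"
    by (rule test_function_bounds[OF t]) blast
  then show ?thesis
    by (intro integral_kernel_tendsto(2)[OF assms(2), of "\<lambda>_ y. \<psi> (y - x)" B r]
        test_function_continuous[OF t]) force+
qed

lemma continuous_correlate:
  assumes \<psi>: "test_function \<psi>" and u: "locally_integrable u"
  shows "continuous_on UNIV (correlate \<psi> u)"
  unfolding continuous_on_sequentially
proof (intro allI ballI impI, elim conjE)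
  fix X and x :: "real^3" assume X: "X \<longlonglongrightarrow> x"
  obtain r B where r: "\<And>x. \<psi> x \<noteq> 0 \<Longrightarrow> norm x \<le> r" and B: "\<And>x. \<bar>\<psi> x\<bar> \<le> B"
    by (rule test_function_bounds[OF \<psi>]) blast
  obtain R where R: "\<And>n. norm (X n) \<le> R"
    using convergent_imp_Bseq[of X] X by (auto simp: convergent_def Bseq_def)
  have "(\<lambda>n. \<integral>y. \<psi> (y - X n) * u y \<partial>lebesgue) \<longlonglongrightarrow> (\<integral>y. \<psi> (y - x) * u y \<partial>lebesgue)"
  proof (rule integral_kernel_tendsto(1)[OF u, of _ B "r + R"])
    show "continuous_on UNIV (\<lambda>y. \<psi> (y - X n))" for n
      by (intro test_function_continuous test_function_translate \<psi>)
    show "\<psi> (y - X n) = 0" if "r + R < norm y" for n y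
      using r[of "y - X n"] R[of n] that norm_triangle_ineq2[of y "X n"] by force
    show "(\<lambda>n. \<psi> (y - X n)) \<longlonglongrightarrow> \<psi> (y - x)" for y
      using test_function_continuous[OF \<psi>]
      by (intro isCont_tendsto_compose[of _ \<psi>] tendsto_intros X)
         (simp add: continuous_on_eq_continuous_at)
  qed (rule B)
  then show "(correlate \<psi> u \<circ> X) \<longlonglongrightarrow> correlate \<psi> u x" by (simp add: correlate_def o_def)
qed

text \<open>
  Differentiation under the integral sign. By the mean value theorem the difference quotients of \<open>\<psi>\<close> are
  bounded by the supremum of its partial derivative, so the previous convergence lemma applies along every
  sequence of increments. The minus sign comes from \<open>x\<close> entering the kernel negatively.
\<close>

lemma correlate_has_partial:
  assumes \<psi>: "test_function \<psi>" and u: "locally_integrable u"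
  shows "((\<lambda>t. correlate \<psi> u (x + t *\<^sub>R axis i 1)) has_real_derivative
           - (\<integral>y. partial_deriv i \<psi> (y - x) * u y \<partial>lebesgue)) (at 0)"
  unfolding has_field_derivative_iff tendsto_at_iff_sequentially
proof (intro allI impI)
  fix T :: "nat \<Rightarrow> real" assume T0: "\<forall>n. T n \<in> UNIV - {0}" and T: "T \<longlonglongrightarrow> 0"
  let ?e = "axis i 1 :: real^3"
  obtain r B where r: "\<And>x. \<psi> x \<noteq> 0 \<Longrightarrow> norm x \<le> r" and B: "\<And>x. \<bar>partial_deriv i \<psi> x\<bar> \<le> B"
    by (rule test_function_bounds[OF \<psi>]) blast
  obtain R where R: "\<And>n. \<bar>T n\<bar> \<le> R" "0 < R"
    using convergent_imp_Bseq[of T] T by (auto simp: convergent_def Bseq_def)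
  define k where "k n y = (\<psi> (y - (x + T n *\<^sub>R ?e)) - \<psi> (y - x)) / T n" for n y
  have "(\<lambda>n. \<integral>y. k n y * u y \<partial>lebesgue) \<longlonglongrightarrow> (\<integral>y. - partial_deriv i \<psi> (y - x) * u y \<partial>lebesgue)"
  proof (rule integral_kernel_tendsto(1)[OF u, of k B "r + norm x + R"])
    show "continuous_on UNIV (k n)" for n
      unfolding k_def[abs_def] using T0
      by (intro continuous_on_divide continuous_on_diff continuous_on_const
          test_function_continuous[OF test_function_translate[OF \<psi>]]) auto
    show "\<bar>k n y\<bar> \<le> B" for n y
    proof -
      have "norm (\<psi> (y - x + (- T n) *\<^sub>R ?e) - \<psi> (y - x + 0 *\<^sub>R ?e)) \<le> B * norm (- T n - 0)"
        by (rule field_differentiable_bound[of UNIV "\<lambda>t. \<psi> (y - x + t *\<^sub>R ?e)"])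
          (use test_function_line_derivative[OF \<psi>] B in auto)
      then show ?thesis
        using T0 by (simp add: k_def algebra_simps divide_simps)
    qed
    show "k n y = 0" if "r + norm x + R < norm y" for n y
    proof -
      have "norm (T n *\<^sub>R ?e) \<le> R" using R(1)[of n] by simp
      then have "r < norm (y - x)" "r < norm (y - (x + T n *\<^sub>R ?e))"
        using that R(2) norm_triangle_ineq2[of y x] norm_triangle_ineq2[of y "x + T n *\<^sub>R ?e"]
          norm_triangle_ineq[of x "T n *\<^sub>R ?e"] by linarith+
      then have "\<psi> (y - x) = 0" "\<psi> (y - (x + T n *\<^sub>R ?e)) = 0" using r by (meson not_less)+
      then show ?thesis by (simp add: k_def)
    qed
    show "(\<lambda>n. k n y) \<longlonglongrightarrow> - partial_deriv i \<psi> (y - x)" for y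
    proof -
      have "((\<lambda>t. \<psi> (y - x + t *\<^sub>R ?e)) has_real_derivative partial_deriv i \<psi> (y - x)) (at (- 0))"
        using test_function_line_derivative[OF \<psi>, of "y - x" i 0] by simp
      from DERIV_chain2[of "\<lambda>t. \<psi> (y - x + t *\<^sub>R ?e)" _ uminus 0 "-1" UNIV, OF this]
      have "((\<lambda>t. \<psi> (y - x + (- t) *\<^sub>R ?e)) has_real_derivative - partial_deriv i \<psi> (y - x)) (at 0)"
        by (simp add: DERIV_minus[OF DERIV_ident, simplified])
      then have "((\<lambda>t. (\<psi> (y - x + (- t) *\<^sub>R ?e) - \<psi> (y - x)) / t) \<longlongrightarrow> - partial_deriv i \<psi> (y - x)) (at 0)"
        by (simp add: has_field_derivative_iff)
      from this[unfolded tendsto_at_iff_sequentially, rule_format, OF _ T] T0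
      show ?thesis by (simp add: o_def k_def algebra_simps)
    qed
  qed
  moreover have "(\<integral>y. k n y * u y \<partial>lebesgue) = (correlate \<psi> u (x + T n *\<^sub>R ?e) - correlate \<psi> u x) / T n" for n
  proof -
    have "(\<integral>y. k n y * u y \<partial>lebesgue) =
       (\<integral>y. (\<psi> (y - (x + T n *\<^sub>R ?e)) * u y - \<psi> (y - x) * u y) / T n \<partial>lebesgue)"
      by (intro Bochner_Integration.integral_cong) (auto simp: k_def algebra_simps diff_divide_distrib)
    then show ?thesis
      by (simp add: correlate_def correlate_integrable[OF \<psi> u])
  qed
  ultimately show "((\<lambda>t. (correlate \<psi> u (x + t *\<^sub>R ?e) - correlate \<psi> u (x + 0 *\<^sub>R ?e)) / (t - 0)) \<circ> T) \<longlonglongrightarrow>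
      - (\<integral>y. partial_deriv i \<psi> (y - x) * u y \<partial>lebesgue)"
    by (simp add: o_def)
qed

text \<open>
  The minus sign of the previous lemma cancels the one in the definition of a weak gradient: the classical
  derivative of a mollification is the mollification of the weak derivative.
\<close>

lemma correlate_has_partial_weak_gradient:
  assumes "test_function \<psi>" "has_weak_gradient u G"
  shows "((\<lambda>t. correlate \<psi> u (x + t *\<^sub>R axis i 1)) has_real_derivative correlate \<psi> (\<lambda>y. G y $ i) x) (at 0)"
proof -
  have "(\<integral>y. u y * partial_deriv i (\<lambda>y. \<psi> (y - x)) y \<partial>lebesgue) = - (\<integral>y. G y $ i * \<psi> (y - x) \<partial>lebesgue)"
    using assms(2) test_function_translate[OF assms(1)] by (simp add: has_weak_gradient_def)
  then have "correlate \<psi> (\<lambda>y. G y $ i) x = - (\<integral>y. partial_deriv i \<psi> (y - x) * u y \<partial>lebesgue)"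
    by (simp add: partial_deriv_translate[OF test_function_differentiable[OF assms(1)]] correlate_def mult.commute)
  then show ?thesis
    using correlate_has_partial[OF assms(1)] assms(2) by (simp add: has_weak_gradient_def)
qed

section \<open>Almost everywhere convergence of mollifications\<close>

lemma locally_integrable_cbox:
  assumes "locally_integrable u"
  shows "u absolutely_integrable_on cbox a b"
  using assms[unfolded locally_integrable_def, rule_format, OF compact_cbox] .

lemma AE_average_tendsto:
  fixes f :: "real^3 \<Rightarrow> real"
  assumes "\<And>a b. f integrable_on cbox a b"
  shows "AE x in lebesgue. \<forall>e>0. \<exists>d>0. \<forall>h. 0 < h \<and> h < d \<longrightarrow>
    \<bar>integral (cbox x (x + h *\<^sub>R One)) f / h ^ 3 - f x\<bar> < e"
proof -
  obtain N where N: "negligible N" and *: "\<And>x e. \<lbrakk>x \<notin> N; 0 < e\<rbrakk> \<Longrightarrow>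
     \<exists>d>0. \<forall>h. 0 < h \<and> h < d \<longrightarrow> norm(integral (cbox x (x + h *\<^sub>R One)) f /\<^sub>R h ^ DIM(real^3) - f x) < e"
    using integrable_ccontinuous_explicit[OF assms] by metis
  have "AE x in lebesgue. x \<notin> N"
    using N by (intro AE_not_in) (simp add: negligible_iff_null_sets)
  then show ?thesis
    by eventually_elim (use * in \<open>simp add: divide_inverse mult.commute\<close>)
qed

text \<open>
  Lebesgue points. The differentiation theorem for the functions \<open>\<lambda>y. \<bar>u y - c\<bar>\<close> with \<open>c\<close> rational excludes only
  countably many null sets; at any other point \<open>x\<close> a rational \<open>c\<close> close to \<open>u x\<close> gives the claim.
\<close>

lemma AE_lebesgue_point:
  fixes u :: "real^3 \<Rightarrow> real"
  assumes u: "locally_integrable u"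
  shows "AE x in lebesgue. \<forall>e>0. \<exists>d>0. \<forall>h. 0 < h \<and> h < d \<longrightarrow>
    integral (cbox x (x + h *\<^sub>R One)) (\<lambda>y. \<bar>u y - u x\<bar>) \<le> e * h ^ 3"
proof -
  have abs_int: "(\<lambda>y. \<bar>u y - c\<bar>) integrable_on cbox a b" for c a b
  proof -
    have "(\<lambda>y. u y - c) absolutely_integrable_on cbox a b"
      by (intro set_integral_diff(1) locally_integrable_cbox u absolutely_integrable_on_const) simp
    then show ?thesis by (simp add: absolutely_integrable_on_def)
  qed
  have "AE x in lebesgue. \<forall>q::rat. \<forall>e>0. \<exists>d>0. \<forall>h. 0 < h \<and> h < d \<longrightarrow>
    \<bar>integral (cbox x (x + h *\<^sub>R One)) (\<lambda>y. \<bar>u y - of_rat q\<bar>) / h ^ 3 - \<bar>u x - of_rat q\<bar>\<bar> < e"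
    unfolding AE_all_countable using AE_average_tendsto[OF abs_int] by blast
  then show ?thesis
  proof eventually_elim
    case (elim x)
    show ?case
    proof (intro allI impI)
      fix e :: real assume e: "0 < e"
      obtain c where "c \<in> \<rat>" "u x - e / 4 < c" "c < u x + e / 4"
        using Rats_dense_in_real[of "u x - e / 4" "u x + e / 4"] e by auto
      then have c: "\<bar>u x - c\<bar> < e / 4" by linarith
      obtain q where q: "c = of_rat q" using \<open>c \<in> \<rat>\<close> by (auto elim: Rats_cases)
      obtain d where d: "0 < d" "\<And>h. 0 < h \<Longrightarrow> h < d \<Longrightarrow>
        \<bar>integral (cbox x (x + h *\<^sub>R One)) (\<lambda>y. \<bar>u y - c\<bar>) / h ^ 3 - \<bar>u x - c\<bar>\<bar> < e / 4"
        using elim[rule_format, of "e / 4" q] e unfolding q by auto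
      have "integral (cbox x (x + h *\<^sub>R One)) (\<lambda>y. \<bar>u y - u x\<bar>) \<le> e * h ^ 3" if h: "0 < h" "h < d" for h
      proof -
        let ?Q = "cbox x (x + h *\<^sub>R One)"
        have "integral ?Q (\<lambda>y. \<bar>u y - u x\<bar>) \<le> integral ?Q (\<lambda>y. \<bar>u y - c\<bar> + \<bar>u x - c\<bar>)"
          by (intro integral_le abs_int integrable_add integrable_const) auto
        also have "\<dots> = integral ?Q (\<lambda>y. \<bar>u y - c\<bar>) + \<bar>u x - c\<bar> * h ^ 3"
          using h by (subst integral_add[OF abs_int integrable_const])
            (simp_all add: content_cbox' inner_add_left box_eq_empty)
        also have "integral ?Q (\<lambda>y. \<bar>u y - c\<bar>) \<le> (\<bar>u x - c\<bar> + e / 4) * h ^ 3"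
        proof -
          have "integral ?Q (\<lambda>y. \<bar>u y - c\<bar>) / h ^ 3 \<le> \<bar>u x - c\<bar> + e / 4"
            using d(2)[OF h] by linarith
          then show ?thesis using h(1) by (simp add: pos_divide_le_eq)
        qed
        also have "(\<bar>u x - c\<bar> + e / 4) * h ^ 3 + \<bar>u x - c\<bar> * h ^ 3 = (2 * \<bar>u x - c\<bar> + e / 4) * h ^ 3"
          by (simp add: algebra_simps)
        also have "\<dots> \<le> e * h ^ 3"
        proof (rule mult_right_mono)
          have "2 * a + e / 4 \<le> e" if "a < e / 4" for a :: real using that e by (simp add: field_simps)
          from this[OF c] show "2 * \<bar>u x - c\<bar> + e / 4 \<le> e" .
        qed (use h in simp)
        finally show ?thesis by simp
      qed
      with d(1) show "\<exists>d>0. \<forall>h. 0 < h \<and> h < d \<longrightarrow>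
          integral (cbox x (x + h *\<^sub>R One)) (\<lambda>y. \<bar>u y - u x\<bar>) \<le> e * h ^ 3" by blast
    qed
  qed
qed

lemma mollifier_shift_integral:
  assumes "0 < h"
  shows "(\<integral>y. mollifier h (y - x) \<partial>lebesgue) = 1" "integrable lebesgue (\<lambda>y. mollifier h (y - x))"
proof -
  have [measurable]: "mollifier h \<in> borel_measurable borel"
    using continuous_mollifier[OF assms] by (rule borel_measurable_continuous_onI)
  have i: "integrable lborel (mollifier h)"
    using mollifier_integral[OF assms] not_integrable_integral_eq by fastforce
  have eq: "lborel = distr lborel borel ((+) (- x))" by (rule lborel_distr_plus[symmetric])
  have "(\<integral>y. mollifier h (y - x) \<partial>lborel) = 1"
    using mollifier_integral[OF assms] by (subst (asm) eq) (simp add: integral_distr add.commute)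
  then show "(\<integral>y. mollifier h (y - x) \<partial>lebesgue) = 1"
    by (subst integral_completion) auto
  then show "integrable lebesgue (\<lambda>y. mollifier h (y - x))"
    using not_integrable_integral_eq by fastforce
qed

text \<open>
  At a Lebesgue point the error is an average of \<open>\<bar>u y - u x\<bar>\<close> with a weight of size at most a constant times
  \<open>h^(-3)\<close> on a cube of volume \<open>h^3\<close>.
\<close>

lemma mollification_AE_tendsto:
  fixes u :: "real^3 \<Rightarrow> real"
  assumes u: "locally_integrable u"
  shows "AE x in lebesgue. (\<lambda>n. correlate (mollifier (1 / real (Suc n))) u x) \<longlonglongrightarrow> u x"
  using AE_lebesgue_point[OF u]
proof eventually_elim
  case (elim x)
  define m where "m = (\<integral>w. bump3 w \<partial>lborel)"
  have m: "0 < m" unfolding m_def by (rule bump3_mass_pos)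
  have key: "\<bar>correlate (mollifier h) u x - u x\<bar> \<le> integral (cbox x (x + h *\<^sub>R One)) (\<lambda>y. \<bar>u y - u x\<bar>) / (h ^ 3 * m)"
    if h: "0 < h" for h
  proof -
    let ?Q = "cbox x (x + h *\<^sub>R One)" and ?\<eta> = "\<lambda>y. mollifier h (y - x)"
    note i1 = correlate_integrable[OF test_function_mollifier[OF h] u, of x]
    note i2 = mollifier_shift_integral[OF h, of x]
    have "(\<lambda>y. u y - u x) absolutely_integrable_on ?Q"
      by (intro set_integral_diff(1) locally_integrable_cbox u absolutely_integrable_on_const) simp
    from absolutely_integrable_norm[OF this]
    have i3: "set_integrable lebesgue ?Q (\<lambda>y. \<bar>u y - u x\<bar>)" by (simp add: o_def)
    have "correlate (mollifier h) u x - u x = (\<integral>y. ?\<eta> y * u y - ?\<eta> y * u x \<partial>lebesgue)"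
      using i1 i2 by (subst Bochner_Integration.integral_diff) (auto simp: correlate_def)
    also have "\<bar>\<dots>\<bar> \<le> (\<integral>y. \<bar>?\<eta> y * u y - ?\<eta> y * u x\<bar> \<partial>lebesgue)"
      by (rule integral_abs_bound)
    also have "\<dots> \<le> (\<integral>y. 1 / (h ^ 3 * m) * (indicator ?Q y *\<^sub>R \<bar>u y - u x\<bar>) \<partial>lebesgue)"
    proof (rule integral_mono)
      show "integrable lebesgue (\<lambda>y. \<bar>?\<eta> y * u y - ?\<eta> y * u x\<bar>)"
        using i1 i2(2) by (intro integrable_abs Bochner_Integration.integrable_diff integrable_mult_left) auto
      show "integrable lebesgue (\<lambda>y. 1 / (h ^ 3 * m) * (indicator ?Q y *\<^sub>R \<bar>u y - u x\<bar>))"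
        using i3 unfolding set_integrable_def by (rule integrable_mult_right)
      fix y
      have "\<bar>?\<eta> y * u y - ?\<eta> y * u x\<bar> = ?\<eta> y * \<bar>u y - u x\<bar>"
        using mollifier_nonneg[OF h] by (simp add: abs_mult flip: right_diff_distrib)
      also have "\<dots> \<le> 1 / (h ^ 3 * m) * (indicator ?Q y *\<^sub>R \<bar>u y - u x\<bar>)"
      proof (cases "y \<in> ?Q")
        case True
        then show ?thesis
          using mult_right_mono[OF mollifier_le[OF h, of "y - x"], of "\<bar>u y - u x\<bar>"] by (simp add: m_def)
      next
        case False
        then have "y - x \<notin> cbox 0 (h *\<^sub>R One)" by (auto simp: mem_box algebra_simps)
        then show ?thesis using mollifier_outside[OF h] False by simp
      qed
      finally show "\<bar>?\<eta> y * u y - ?\<eta> y * u x\<bar> \<le> 1 / (h ^ 3 * m) * (indicator ?Q y *\<^sub>R \<bar>u y - u x\<bar>)" .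
    qed
    also have "\<dots> = 1 / (h ^ 3 * m) * (LINT y:?Q|lebesgue. \<bar>u y - u x\<bar>)"
      unfolding set_lebesgue_integral_def by (rule integral_mult_right_zero)
    also have "\<dots> = integral ?Q (\<lambda>y. \<bar>u y - u x\<bar>) / (h ^ 3 * m)"
      unfolding set_lebesgue_integral_eq_integral(2)[OF i3] by simp
    finally show ?thesis .
  qed
  show ?case
  proof (rule LIMSEQ_I)
    fix e :: real assume e: "0 < e"
    then have "0 < e * m / 2" using m by simp
    then obtain d where d: "0 < d" "\<And>h. 0 < h \<Longrightarrow> h < d \<Longrightarrow>
        integral (cbox x (x + h *\<^sub>R One)) (\<lambda>y. \<bar>u y - u x\<bar>) \<le> e * m / 2 * h ^ 3"
      using elim by blast
    obtain n0 where n0: "inverse (real (Suc n0)) < d" using reals_Archimedean[OF d(1)] by blast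
    have "norm (correlate (mollifier (1 / real (Suc n))) u x - u x) < e" if "n0 \<le> n" for n
    proof -
      define h where "h = 1 / real (Suc n)"
      have "h \<le> inverse (real (Suc n0))" using that by (simp add: h_def divide_simps)
      then have h: "0 < h" "h < d" using n0 by (auto simp: h_def)
      have "\<bar>correlate (mollifier h) u x - u x\<bar> \<le> (e * m / 2 * h ^ 3) / (h ^ 3 * m)"
        using key[OF h(1)] h(1) m
        by (elim order_trans) (intro divide_right_mono d(2)[OF h], simp)
      also have "\<dots> < e" using e h m by simp
      finally show ?thesis by (simp add: h_def)
    qed
    then show "\<exists>n0. \<forall>n\<ge>n0. norm (correlate (mollifier (1 / real (Suc n))) u x - u x) < e" by blast
  qed
qed

section \<open>Square integrals of mollifications\<close>

lemma nn_integral_lborel_reflect: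
  fixes f :: "real^3 \<Rightarrow> ennreal"
  assumes [measurable]: "f \<in> borel_measurable borel"
  shows "(\<integral>\<^sup>+x. f (y - x) \<partial>lborel) = (\<integral>\<^sup>+x. f x \<partial>lborel)"
proof -
  have "(\<integral>\<^sup>+x. f x \<partial>lborel) =
      (\<integral>\<^sup>+x. f x \<partial>density (distr lborel borel (\<lambda>x. y + (- 1) *\<^sub>R x)) (\<lambda>_. ennreal (\<bar>- 1\<bar> ^ DIM(real^3))))"
    using arg_cong[OF lborel_affine[of "- 1" y], of "\<lambda>M. \<integral>\<^sup>+x. f x \<partial>M"] by simp
  also have "\<dots> = (\<integral>\<^sup>+x. f (y - x) \<partial>lborel)"
    by (simp add: density_1 nn_integral_distr)
  finally show ?thesis by simp
qed

text \<open>
  Jensen's inequality for the square and the probability density \<open>y \<mapsto> mollifier h (y - x)\<close>, obtained from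
  the Cauchy-Schwarz inequality by splitting the density into two square roots.
\<close>

lemma mollification_square_le:
  fixes g :: "real^3 \<Rightarrow> real"
  assumes h: "0 < h" and [measurable]: "g \<in> borel_measurable lebesgue"
  shows "ennreal ((correlate (mollifier h) g x)\<^sup>2) \<le> (\<integral>\<^sup>+y. ennreal (mollifier h (y - x)) * ennreal ((g y)\<^sup>2) \<partial>lborel)"
proof -
  have [measurable]: "mollifier h \<in> borel_measurable borel"
    using continuous_mollifier[OF h] by (rule borel_measurable_continuous_onI)
  have [measurable]: "(\<lambda>y. mollifier h (y - x)) \<in> borel_measurable lebesgue"
    by (rule borel_imp_lebesgue_measurable) measurable
  let ?\<eta> = "\<lambda>y. mollifier h (y - x)"
  have mass: "(\<integral>\<^sup>+y. ennreal (?\<eta> y) \<partial>lborel) = 1"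
  proof -
    have "(\<integral>\<^sup>+y. ennreal (?\<eta> y) \<partial>lebesgue) = ennreal 1"
      using mollifier_shift_integral[OF h, of x] mollifier_nonneg[OF h]
      by (subst nn_integral_eq_integral) auto
    then show ?thesis by (simp add: nn_integral_completion)
  qed
  have "ennreal ((correlate (mollifier h) g x)\<^sup>2) = (ennreal \<bar>correlate (mollifier h) g x\<bar>)\<^sup>2"
    by (simp add: ennreal_power)
  also have "ennreal \<bar>correlate (mollifier h) g x\<bar> \<le> (\<integral>\<^sup>+y. ennreal \<bar>?\<eta> y * g y\<bar> \<partial>lebesgue)"
    using integral_norm_bound_ennreal[of lebesgue "\<lambda>y. ?\<eta> y * g y"]
      not_integrable_integral_eq[of lebesgue "\<lambda>y. ?\<eta> y * g y"]
    by (cases "integrable lebesgue (\<lambda>y. ?\<eta> y * g y)") (auto simp: correlate_def)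
  also have "\<dots> = (\<integral>\<^sup>+y. ennreal (sqrt (?\<eta> y)) * ennreal (sqrt (?\<eta> y) * \<bar>g y\<bar>) \<partial>lebesgue)"
    using mollifier_nonneg[OF h]
    by (intro nn_integral_cong) (simp add: abs_mult flip: ennreal_mult'' mult.assoc)
  also have "\<dots>\<^sup>2 \<le> (\<integral>\<^sup>+y. (ennreal (sqrt (?\<eta> y)))\<^sup>2 \<partial>lebesgue) *
      (\<integral>\<^sup>+y. (ennreal (sqrt (?\<eta> y) * \<bar>g y\<bar>))\<^sup>2 \<partial>lebesgue)"
    by (rule Cauchy_Schwarz_nn_integral) auto
  also have "(\<integral>\<^sup>+y. (ennreal (sqrt (?\<eta> y)))\<^sup>2 \<partial>lebesgue) = 1"
    using mollifier_nonneg[OF h] mass by (simp add: ennreal_power nn_integral_completion)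
  also have "(\<integral>\<^sup>+y. (ennreal (sqrt (?\<eta> y) * \<bar>g y\<bar>))\<^sup>2 \<partial>lebesgue) =
      (\<integral>\<^sup>+y. ennreal (?\<eta> y) * ennreal ((g y)\<^sup>2) \<partial>lebesgue)"
    using mollifier_nonneg[OF h]
    by (intro nn_integral_cong) (simp add: ennreal_power power_mult_distrib flip: ennreal_mult'')
  finally show ?thesis by (simp add: power_mono nn_integral_completion)
qed

text \<open>
  Follows from the previous inequality and the pointwise bound on the mollifier. The bound depends on \<open>h\<close>; it serves
  only to know in advance that powers of a mollification have finite integrals.
\<close>

lemma mollification_bounded:
  fixes g :: "real^3 \<Rightarrow> real"
  assumes h: "0 < h" and [measurable]: "g \<in> borel_measurable lebesgue"
    and fin: "(\<integral>\<^sup>+x. ennreal ((g x)\<^sup>2) \<partial>lebesgue) < \<infinity>"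
  obtains B where "\<And>x. \<bar>correlate (mollifier h) g x\<bar> \<le> B"
proof -
  define c where "c = 1 / (h ^ 3 * (\<integral>w. bump3 w \<partial>lborel))"
  obtain I where I: "(\<integral>\<^sup>+x. ennreal ((g x)\<^sup>2) \<partial>lebesgue) = ennreal I" "0 \<le> I"
    using fin by (cases "\<integral>\<^sup>+x. ennreal ((g x)\<^sup>2) \<partial>lebesgue") auto
  have c: "0 \<le> c" using h bump3_mass_pos by (simp add: c_def)
  have "(correlate (mollifier h) g x)\<^sup>2 \<le> c * I" for x
  proof -
    have "ennreal ((correlate (mollifier h) g x)\<^sup>2) \<le>
        (\<integral>\<^sup>+y. ennreal (mollifier h (y - x)) * ennreal ((g y)\<^sup>2) \<partial>lebesgue)"
      using mollification_square_le[OF h assms(2)] by (simp add: nn_integral_completion)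
    also have "\<dots> \<le> (\<integral>\<^sup>+y. ennreal c * ennreal ((g y)\<^sup>2) \<partial>lebesgue)"
      using mollifier_le[OF h] by (intro nn_integral_mono mult_right_mono ennreal_leI) (auto simp: c_def)
    also have "\<dots> = ennreal (c * I)"
      using c I by (simp add: nn_integral_cmult ennreal_mult)
    finally show ?thesis using c I(2) by (simp add: ennreal_le_iff)
  qed
  then have "\<bar>correlate (mollifier h) g x\<bar> \<le> sqrt (c * I)" for x
    by (metis real_sqrt_abs real_sqrt_le_mono)
  then show ?thesis by (rule that)
qed

text \<open>
  Integrate the pointwise Jensen inequality and exchange the integrals. Tonelli's theorem needs joint Borel
  measurability, hence the passage to a Borel representative of \<open>g\<close>.
\<close>

lemma mollification_L2_le:
  fixes g :: "real^3 \<Rightarrow> real"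
  assumes h: "0 < h" and g: "g \<in> borel_measurable lebesgue"
  shows "(\<integral>\<^sup>+x. ennreal ((correlate (mollifier h) g x)\<^sup>2) \<partial>lborel) \<le> (\<integral>\<^sup>+x. ennreal ((g x)\<^sup>2) \<partial>lborel)"
proof -
  have [measurable]: "mollifier h \<in> borel_measurable borel"
    using continuous_mollifier[OF h] by (rule borel_measurable_continuous_onI)
  obtain g' where [measurable]: "g' \<in> borel_measurable borel" and g': "AE x in lborel. g x = g' x"
    using completion_ex_borel_measurable_real[OF g] by auto
  have "(\<integral>\<^sup>+x. ennreal ((correlate (mollifier h) g x)\<^sup>2) \<partial>lborel)
      \<le> (\<integral>\<^sup>+x. \<integral>\<^sup>+y. ennreal (mollifier h (y - x)) * ennreal ((g y)\<^sup>2) \<partial>lborel \<partial>lborel)"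
    by (intro nn_integral_mono mollification_square_le[OF h g])
  also have "\<dots> = (\<integral>\<^sup>+x. \<integral>\<^sup>+y. ennreal (mollifier h (y - x)) * ennreal ((g' y)\<^sup>2) \<partial>lborel \<partial>lborel)"
    using g' by (intro nn_integral_cong nn_integral_cong_AE) auto
  also have "\<dots> = (\<integral>\<^sup>+y. \<integral>\<^sup>+x. ennreal (mollifier h (y - x)) * ennreal ((g' y)\<^sup>2) \<partial>lborel \<partial>lborel)"
    by (rule lborel_pair.Fubini'[symmetric]) measurable
  also have "\<dots> = (\<integral>\<^sup>+y. ennreal ((g' y)\<^sup>2) \<partial>lborel)"
  proof (rule nn_integral_cong)
    fix y :: "real^3"
    have "(\<integral>\<^sup>+x. ennreal (mollifier h (y - x)) \<partial>lborel) = (\<integral>\<^sup>+x. ennreal (mollifier h (x - 0)) \<partial>lebesgue)"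
      by (subst nn_integral_lborel_reflect) (auto simp: nn_integral_completion)
    also have "\<dots> = 1"
      using mollifier_shift_integral[OF h, of 0] mollifier_nonneg[OF h]
      by (subst nn_integral_eq_integral) auto
    finally show "(\<integral>\<^sup>+x. ennreal (mollifier h (y - x)) * ennreal ((g' y)\<^sup>2) \<partial>lborel) = ennreal ((g' y)\<^sup>2)"
      by (subst nn_integral_multc) auto
  qed
  also have "\<dots> = (\<integral>\<^sup>+y. ennreal ((g y)\<^sup>2) \<partial>lborel)"
    using g' by (intro nn_integral_cong_AE) auto
  finally show ?thesis .
qed

section \<open>Weak gradients\<close>

lemma locally_integrable_measurable:
  assumes "locally_integrable f"
  shows "f \<in> borel_measurable lebesgue"
proof (rule borel_measurable_LIMSEQ_metric)
  show "(\<lambda>y. indicator (cball 0 (real n)) y *\<^sub>R f y) \<in> borel_measurable lebesgue" for n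
    using locally_integrable_cball[OF assms] by (rule borel_measurable_integrable)
  show "(\<lambda>n. indicator (cball 0 (real n)) x *\<^sub>R f x) \<longlonglongrightarrow> f x" for x
  proof (rule tendsto_eventually)
    obtain n0 :: nat where "norm x \<le> real n0" using real_arch_simple by blast
    then show "\<forall>\<^sub>F n in sequentially. indicator (cball 0 (real n)) x *\<^sub>R f x = f x"
      by (auto simp: eventually_sequentially intro!: exI[of _ n0])
  qed
qed

lemma locally_integrable_component:
  fixes G :: "real^3 \<Rightarrow> real^3"
  assumes "locally_integrable G"
  shows "locally_integrable (\<lambda>x. G x $ i)"
  unfolding locally_integrable_def
proof (intro allI impI)
  fix K :: "(real^3) set" assume "compact K"
  then have "G absolutely_integrable_on K" using assms by (simp add: locally_integrable_def)
  from absolutely_integrable_component[OF this, of "axis i 1"]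
  show "(\<lambda>x. G x $ i) absolutely_integrable_on K" by (simp add: cart_eq_inner_axis)
qed

lemma continuous_locally_integrable:
  fixes f :: "real^3 \<Rightarrow> 'b::euclidean_space"
  assumes f: "continuous_on UNIV f"
  shows "locally_integrable f"
  unfolding locally_integrable_def set_integrable_def
proof (intro allI impI)
  fix K :: "(real^3) set" assume K: "compact K"
  have i: "integrable lborel (\<lambda>x. indicator K x *\<^sub>R f x)"
    by (intro borel_integrable_compact K continuous_on_subset[OF f]) simp
  then show "integrable lebesgue (\<lambda>x. indicator K x *\<^sub>R f x)"
    using integrable_completion[OF borel_measurable_integrable[OF i]] by simp
qed

text \<open>
  All weak gradients of \<open>u\<close> have the same mollifications, namely the partial derivatives of the mollified
  \<open>u\<close>, and these converge almost everywhere to each of them.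
\<close>

lemma weak_gradient_unique:
  assumes G: "has_weak_gradient u G" and G': "has_weak_gradient u G'"
  shows "AE x in lebesgue. G x = G' x"
proof -
  have eq: "correlate (mollifier h) (\<lambda>y. G y $ i) x = correlate (mollifier h) (\<lambda>y. G' y $ i) x" if "0 < h" for h i x
    using correlate_has_partial_weak_gradient[OF test_function_mollifier[OF that] G]
      correlate_has_partial_weak_gradient[OF test_function_mollifier[OF that] G']
    by (rule DERIV_unique)
  have "AE x in lebesgue. G x $ i = G' x $ i" for i
  proof -
    have "locally_integrable (\<lambda>y. G y $ i)" "locally_integrable (\<lambda>y. G' y $ i)"
      using G G' by (auto simp: has_weak_gradient_def intro: locally_integrable_component)
    from mollification_AE_tendsto[OF this(1)] mollification_AE_tendsto[OF this(2)]
    show ?thesis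
    proof eventually_elim
      case (elim x)
      have "(\<lambda>n. correlate (mollifier (1 / real (Suc n))) (\<lambda>y. G y $ i) x) \<longlonglongrightarrow> G' x $ i"
        using elim(2) by (subst eq) auto
      then show ?case using elim(1) by (rule LIMSEQ_unique[rotated])
    qed
  qed
  then have "AE x in lebesgue. \<forall>i. G x $ i = G' x $ i" by (simp add: AE_all_countable)
  then show ?thesis by eventually_elim (simp add: vec_eq_iff)
qed

lemma weak_grad_weak_gradient: "weakly_differentiable u \<Longrightarrow> has_weak_gradient u (weak_grad u)"
  unfolding weakly_differentiable_def weak_grad_def by (fact someI_ex)

lemma weak_grad_AE_eq:
  assumes "has_weak_gradient u G"
  shows "AE x in lebesgue. weak_grad u x = G x"
  using weak_grad_weak_gradient assms
  by (intro weak_gradient_unique[of u]) (auto simp: weakly_differentiable_def)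

lemma partial_line_derivative:
  fixes f :: "real^3 \<Rightarrow> real"
  assumes "\<And>x. ((\<lambda>t. f (x + t *\<^sub>R e)) has_real_derivative f' x) (at 0)"
  shows "((\<lambda>t. f (x + t *\<^sub>R e)) has_real_derivative f' (x + s *\<^sub>R e)) (at s)"
proof -
  have "((\<lambda>t. f (x + (t + s) *\<^sub>R e)) has_real_derivative f' (x + s *\<^sub>R e)) (at 0)"
    using assms[of "x + s *\<^sub>R e"] by (simp add: algebra_simps)
  then show ?thesis
    using DERIV_shift[of "\<lambda>t. f (x + t *\<^sub>R e)" "f' (x + s *\<^sub>R e)" 0 s] by simp
qed

text \<open>
  The difference quotients of \<open>f\<close> have integral zero by translation invariance, and they converge boundedly
  to \<open>f'\<close> on a bounded set.
\<close>

lemma integral_partial_compact_support: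
  fixes f f' :: "real^3 \<Rightarrow> real"
  assumes f: "continuous_on UNIV f" and f': "continuous_on UNIV f'"
    and supp: "\<And>x. r < norm x \<Longrightarrow> f x = 0" "\<And>x. r < norm x \<Longrightarrow> f' x = 0"
    and D: "\<And>x. ((\<lambda>t. f (x + t *\<^sub>R axis i 1)) has_real_derivative f' x) (at 0)"
  shows "(\<integral>x. f' x \<partial>lebesgue) = 0"
proof -
  let ?e = "axis i 1 :: real^3"
  define T where "T n = 1 / real (Suc n)" for n
  have T: "0 < T n" "T n \<le> 1" for n by (auto simp: T_def)
  have T0: "T \<longlonglongrightarrow> 0" unfolding T_def[abs_def] by (rule LIMSEQ_Suc[OF lim_1_over_n])
  define k where "k n x = (f (x + T n *\<^sub>R ?e) - f x) / T n" for n x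
  have "bounded (f' ` cball 0 r)"
    by (intro compact_imp_bounded compact_continuous_image continuous_on_subset[OF f']) auto
  then obtain B where "\<forall>y\<in>f' ` cball 0 r. norm y \<le> B" unfolding bounded_iff by blast
  then have "\<bar>f' x\<bar> \<le> B" if "norm x \<le> r" for x using that by auto
  then have B: "\<bar>f' x\<bar> \<le> max B 0" for x using supp(2)[of x] by (cases "norm x \<le> r") force+
  have one: "locally_integrable (\<lambda>_::real^3. 1::real)"
    by (intro continuous_locally_integrable continuous_on_const)
  have "(\<lambda>n. \<integral>x. k n x * 1 \<partial>lebesgue) \<longlonglongrightarrow> (\<integral>x. f' x * 1 \<partial>lebesgue)"
  proof (rule integral_kernel_tendsto(1)[OF one, of k "max B 0" "r + 1"])
    show "continuous_on UNIV (k n)" for n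
      unfolding k_def[abs_def] using T(1)[of n]
      by (intro continuous_on_divide continuous_on_diff f continuous_on_const
          continuous_on_compose2[OF f] continuous_on_add continuous_on_id) auto
    show "\<bar>k n x\<bar> \<le> max B 0" for n x
    proof -
      have "norm (f (x + T n *\<^sub>R ?e) - f (x + 0 *\<^sub>R ?e)) \<le> max B 0 * norm (T n - 0)"
        by (rule field_differentiable_bound[of UNIV "\<lambda>t. f (x + t *\<^sub>R ?e)"])
          (use partial_line_derivative[OF D] B in auto)
      then show ?thesis using T(1)[of n] by (simp add: k_def divide_simps)
    qed
    show "k n x = 0" if "r + 1 < norm x" for n x
    proof -
      have "norm (T n *\<^sub>R ?e) \<le> 1" using T[of n] by simp
      then have "r < norm (x + T n *\<^sub>R ?e)"
        using that norm_triangle_ineq2[of x "- (T n *\<^sub>R ?e)"] by simp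
      then show ?thesis using that by (simp add: k_def supp)
    qed
    show "(\<lambda>n. k n x) \<longlonglongrightarrow> f' x" for x
    proof -
      have "((\<lambda>t. (f (x + t *\<^sub>R ?e) - f x) / t) \<longlongrightarrow> f' x) (at 0)"
        using D[of x] by (simp add: has_field_derivative_iff)
      moreover have "\<forall>n. T n \<in> UNIV - {0}" using T by (metis DiffI UNIV_I less_irrefl singletonD)
      ultimately have "((\<lambda>t. (f (x + t *\<^sub>R ?e) - f x) / t) \<circ> T) \<longlonglongrightarrow> f' x"
        using T0 unfolding tendsto_at_iff_sequentially by blast
      then show ?thesis by (simp add: o_def k_def)
    qed
  qed
  moreover have "(\<integral>x. k n x * 1 \<partial>lebesgue) = 0" for n
  proof -
    have [measurable]: "f \<in> borel_measurable borel" using f by (rule borel_measurable_continuous_onI)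
    have "integrable lebesgue (\<lambda>x. f x * 1)"
    proof -
      have "bounded (f ` cball 0 r)"
        by (intro compact_imp_bounded compact_continuous_image continuous_on_subset[OF f]) auto
      then obtain C where "\<forall>y\<in>f ` cball 0 r. norm y \<le> C" unfolding bounded_iff by blast
      then have "\<bar>f x\<bar> \<le> C" if "norm x \<le> r" for x using that by auto
      then have C: "\<bar>f x\<bar> \<le> max C 0" for x using supp(1)[of x] by (cases "norm x \<le> r") force+
      show ?thesis
        by (rule integral_kernel_tendsto(2)[OF one, of "\<lambda>_. f" "max C 0" r]) (use f supp(1) C in auto)
    qed
    then have i: "integrable lborel f" by (simp add: integrable_completion)
    have tr: "integrable lborel (\<lambda>x. f (x + c))" "(\<integral>x. f (x + c) \<partial>lborel) = (\<integral>x. f x \<partial>lborel)" for c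
    proof -
      have eq: "distr lborel borel ((+) c) = (lborel :: (real^3) measure)" by (rule lborel_distr_plus)
      have "integrable (distr lborel borel ((+) c)) f" unfolding eq by (rule i)
      then show "integrable lborel (\<lambda>x. f (x + c))"
        by (subst (asm) integrable_distr_eq) (auto simp: add.commute)
      have "(\<integral>x. f x \<partial>lborel) = (\<integral>x. f x \<partial>distr lborel borel ((+) c))" unfolding eq ..
      also have "\<dots> = (\<integral>x. f (x + c) \<partial>lborel)" by (subst integral_distr) (auto simp: add.commute)
      finally show "(\<integral>x. f (x + c) \<partial>lborel) = (\<integral>x. f x \<partial>lborel)" ..
    qed
    have "(\<integral>x. k n x \<partial>lborel) = 0" unfolding k_def by (simp add: tr i)
    moreover have "k n \<in> borel_measurable lborel" unfolding k_def[abs_def] by measurable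
    ultimately show ?thesis by (simp add: integral_completion)
  qed
  ultimately show ?thesis by (simp add: LIMSEQ_const_iff)
qed

text \<open>
  Integration by parts: the product \<open>\<psi> * v\<close> has compact support, so the integral of its partial derivative
  vanishes by the previous lemma.
\<close>

lemma has_weak_gradient_partials:
  fixes v :: "real^3 \<Rightarrow> real" and g :: "3 \<Rightarrow> real^3 \<Rightarrow> real"
  assumes v: "continuous_on UNIV v" and g: "\<And>i. continuous_on UNIV (g i)"
    and D: "\<And>i x. ((\<lambda>t. v (x + t *\<^sub>R axis i 1)) has_real_derivative g i x) (at 0)"
  shows "has_weak_gradient v (\<lambda>x. \<chi> i. g i x)"
  unfolding has_weak_gradient_def
proof (intro conjI allI impI)
  show v': "locally_integrable v" by (rule continuous_locally_integrable) fact
  show "locally_integrable (\<lambda>x. \<chi> i. g i x)"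
    by (intro continuous_locally_integrable continuous_on_vec_lambda g)
  fix \<psi> i assume \<psi>: "test_function \<psi>"
  obtain r B where r: "\<And>x. \<psi> x \<noteq> 0 \<Longrightarrow> norm x \<le> r" "\<And>x. partial_deriv i \<psi> x \<noteq> 0 \<Longrightarrow> norm x \<le> r"
    and B: "\<And>x. \<bar>\<psi> x\<bar> \<le> B" "\<And>x. \<bar>partial_deriv i \<psi> x\<bar> \<le> B"
    by (rule test_function_bounds[OF \<psi>]) blast
  note c = test_function_continuous[OF \<psi>] test_function_continuous_partial[OF \<psi>, of i]
  have z: "\<psi> x = 0" "partial_deriv i \<psi> x = 0" if "r < norm x" for x
    using that r by (meson not_less)+
  have i1: "integrable lebesgue (\<lambda>x. partial_deriv i \<psi> x * v x)"
    by (rule integral_kernel_tendsto(2)[OF v', of "\<lambda>_. partial_deriv i \<psi>" B r]) (use c B z in auto)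
  have i2: "integrable lebesgue (\<lambda>x. \<psi> x * g i x)"
    by (rule integral_kernel_tendsto(2)[OF continuous_locally_integrable[OF g], of "\<lambda>_. \<psi>" B r])
      (use c B z in auto)
  have "(\<integral>x. partial_deriv i \<psi> x * v x + \<psi> x * g i x \<partial>lebesgue) = 0"
  proof (rule integral_partial_compact_support[where f = "\<lambda>x. \<psi> x * v x" and i = i and r = r])
    show "continuous_on UNIV (\<lambda>x. \<psi> x * v x)"
      "continuous_on UNIV (\<lambda>x. partial_deriv i \<psi> x * v x + \<psi> x * g i x)"
      by (intro continuous_on_add continuous_on_mult c v g)+
    show "((\<lambda>t. \<psi> (x + t *\<^sub>R axis i 1) * v (x + t *\<^sub>R axis i 1)) has_real_derivative
        partial_deriv i \<psi> x * v x + \<psi> x * g i x) (at 0)" for x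
      using DERIV_mult[OF test_function_line_derivative[OF \<psi>, of x i 0] D[of x i]]
      by (simp add: algebra_simps)
  qed (use z in auto)
  then have "(\<integral>x. partial_deriv i \<psi> x * v x \<partial>lebesgue) = - (\<integral>x. \<psi> x * g i x \<partial>lebesgue)"
    using i1 i2 by simp
  then show "(\<integral>x. v x * partial_deriv i \<psi> x \<partial>lebesgue) = - (\<integral>x. (\<chi> i. g i x) $ i * \<psi> x \<partial>lebesgue)"
    by (simp add: mult.commute)
qed

section \<open>The Loomis-Whitney inequality\<close>

text \<open>
  The line integrals to which the Loomis-Whitney inequality is applied may be infinite, so their square
  roots are taken in \<^typ>\<open>ennreal\<close>.
\<close>

definition esqrt :: "ennreal \<Rightarrow> ennreal" where
  "esqrt x = (if x = \<infinity> then \<infinity> else ennreal (sqrt (enn2real x)))"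

lemma esqrt_measurable [measurable]: "esqrt \<in> borel_measurable borel"
  unfolding esqrt_def[abs_def] by measurable

lemma esqrt_square: "(esqrt x)\<^sup>2 = x"
  by (cases x) (auto simp: esqrt_def ennreal_power)

lemma le_esqrt:
  assumes "0 \<le> a" "ennreal (a\<^sup>2) \<le> x" shows "ennreal a \<le> esqrt x"
  using assms by (cases x) (auto simp: esqrt_def intro!: ennreal_leI real_le_rsqrt)

lemma ennreal_power2_le_imp_le:
  assumes "x\<^sup>2 \<le> (ennreal a)\<^sup>2" "0 \<le> a" shows "x \<le> ennreal a"
proof (cases x)
  case (real r)
  then have "r\<^sup>2 \<le> a\<^sup>2" using assms by (simp add: ennreal_power)
  then have "r \<le> a" using assms(2) by (rule power2_le_imp_le)
  then show ?thesis using real by (simp add: ennreal_leI)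
next
  case top
  then show ?thesis using assms by (simp add: ennreal_power top_unique)
qed

lemma nn_integral_lborel_pair:
  fixes f :: "real \<times> real \<Rightarrow> ennreal"
  assumes [measurable]: "f \<in> borel_measurable borel"
  shows "(\<integral>\<^sup>+p. f p \<partial>lborel) = (\<integral>\<^sup>+a. \<integral>\<^sup>+b. f (a, b) \<partial>lborel \<partial>lborel)"
  using lborel.nn_integral_fst[of f lborel] by (simp add: lborel_prod)

text \<open>
  The three-dimensional Loomis-Whitney inequality in squared form, where \<open>p = (a, b)\<close>. Apply the Cauchy-Schwarz
  inequality in \<open>c\<close> to bound the inner integral \<open>H\<close>, and then once more in \<open>(a, b)\<close> to separate \<open>H\<close> from \<open>k\<close>;
  the bound for \<open>H\<^sup>2\<close> splits into a function of \<open>a\<close> times a function of \<open>b\<close>.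
\<close>

lemma loomis_whitney:
  fixes f g k :: "real \<times> real \<Rightarrow> ennreal"
  assumes [measurable]: "f \<in> borel_measurable borel" "g \<in> borel_measurable borel" "k \<in> borel_measurable borel"
  shows "(\<integral>\<^sup>+p. \<integral>\<^sup>+c. f (snd p, c) * g (fst p, c) * k p \<partial>lborel \<partial>lborel)\<^sup>2 \<le>
    (\<integral>\<^sup>+p. (f p)\<^sup>2 \<partial>lborel) * (\<integral>\<^sup>+p. (g p)\<^sup>2 \<partial>lborel) * (\<integral>\<^sup>+p. (k p)\<^sup>2 \<partial>lborel)"
proof -
  define F where "F b = (\<integral>\<^sup>+c. (f (b, c))\<^sup>2 \<partial>lborel)" for b
  define G where "G a = (\<integral>\<^sup>+c. (g (a, c))\<^sup>2 \<partial>lborel)" for a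
  define H where "H p = (\<integral>\<^sup>+c. f (snd p, c) * g (fst p, c) \<partial>lborel)" for p
  have [measurable]: "f \<in> borel_measurable (borel \<Otimes>\<^sub>M borel)" "g \<in> borel_measurable (borel \<Otimes>\<^sub>M borel)"
    using assms by (simp_all add: borel_prod)
  have [measurable]: "F \<in> borel_measurable borel" "G \<in> borel_measurable borel"
    unfolding F_def[abs_def] G_def[abs_def] by measurable
  have "H \<in> borel_measurable (borel \<Otimes>\<^sub>M borel)"
    unfolding H_def[abs_def] by measurable
  then have [measurable]: "H \<in> borel_measurable borel" by (simp add: borel_prod)
  have "(\<lambda>p. F (snd p) * G (fst p)) \<in> borel_measurable (borel \<Otimes>\<^sub>M borel)" by measurable
  then have [measurable]: "(\<lambda>p. F (snd p) * G (fst p)) \<in> borel_measurable borel"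
    by (simp add: borel_prod)
  have H: "(H p)\<^sup>2 \<le> F (snd p) * G (fst p)" for p
    unfolding H_def F_def G_def by (rule Cauchy_Schwarz_nn_integral) measurable
  have "(\<integral>\<^sup>+p. \<integral>\<^sup>+c. f (snd p, c) * g (fst p, c) * k p \<partial>lborel \<partial>lborel) = (\<integral>\<^sup>+p. H p * k p \<partial>lborel)"
    unfolding H_def by (intro nn_integral_cong nn_integral_multc) measurable
  also have "\<dots>\<^sup>2 \<le> (\<integral>\<^sup>+p. (H p)\<^sup>2 \<partial>lborel) * (\<integral>\<^sup>+p. (k p)\<^sup>2 \<partial>lborel)"
    by (rule Cauchy_Schwarz_nn_integral) measurable
  also have "\<dots> \<le> (\<integral>\<^sup>+p. F (snd p) * G (fst p) \<partial>lborel) * (\<integral>\<^sup>+p. (k p)\<^sup>2 \<partial>lborel)"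
    by (intro mult_right_mono nn_integral_mono H) simp
  also have "(\<integral>\<^sup>+p. F (snd p) * G (fst p) \<partial>lborel) = (\<integral>\<^sup>+a. \<integral>\<^sup>+b. F b * G a \<partial>lborel \<partial>lborel)"
    by (subst nn_integral_lborel_pair) auto
  also have "\<dots> = (\<integral>\<^sup>+b. F b \<partial>lborel) * (\<integral>\<^sup>+a. G a \<partial>lborel)"
    by (simp add: nn_integral_multc nn_integral_cmult)
  also have "(\<integral>\<^sup>+b. F b \<partial>lborel) = (\<integral>\<^sup>+p. (f p)\<^sup>2 \<partial>lborel)"
    unfolding F_def by (subst nn_integral_lborel_pair) auto
  also have "(\<integral>\<^sup>+a. G a \<partial>lborel) = (\<integral>\<^sup>+p. (g p)\<^sup>2 \<partial>lborel)"
    unfolding G_def by (subst nn_integral_lborel_pair) auto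
  finally show ?thesis .
qed

section \<open>Integration over three-space in coordinates\<close>

text \<open>
  The point with coordinates \<open>i\<close> and \<open>j\<close> given by \<open>p\<close> and the remaining one by \<open>t\<close>. Keeping \<open>i\<close> and \<open>j\<close> as
  parameters lets one integration formula serve for lines in all three coordinate directions.
\<close>

definition coords :: "3 \<Rightarrow> 3 \<Rightarrow> real \<times> real \<Rightarrow> real \<Rightarrow> real^3" where
  "coords i j p t = (\<chi> m. if m = i then fst p else if m = j then snd p else t)"

lemma continuous_coords: "continuous_on UNIV (\<lambda>(p, t). coords i j p t)"
  unfolding coords_def case_prod_beta
proof (rule continuous_on_vec_lambda)
  show "continuous_on UNIV (\<lambda>x. if m = i then fst (fst x) else if m = j then snd (fst x) else snd x)"
    for m and i j :: 3
    by (cases "m = i"; cases "m = j")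
      (simp_all add: continuous_on_fst continuous_on_snd continuous_on_id)
qed

lemma coords_measurable [measurable]:
  "(\<lambda>(p, t). coords i j p t) \<in> borel_measurable borel"
  "(\<lambda>(p, t). coords i j p t) \<in> borel_measurable (borel \<Otimes>\<^sub>M borel)"
  using borel_measurable_continuous_onI[OF continuous_coords] by (simp_all add: borel_prod)

text \<open>
  The map \<^const>\<open>coords\<close> preserves Lebesgue measure, because preimages of boxes are products of intervals
  with the same side lengths.
\<close>

lemma nn_integral_coords:
  fixes F :: "real^3 \<Rightarrow> ennreal"
  assumes [measurable]: "F \<in> borel_measurable borel"
    and ij: "i \<noteq> j" "i \<noteq> k" "j \<noteq> k" "UNIV = {i, j, k :: 3}"
  shows "(\<integral>\<^sup>+x. F x \<partial>lborel) = (\<integral>\<^sup>+p. \<integral>\<^sup>+t. F (coords i j p t) \<partial>lborel \<partial>lborel)"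
proof -
  let ?T = "\<lambda>(p, t). coords i j p t"
  have all3: "(\<forall>m. P m) \<longleftrightarrow> P i \<and> P j \<and> P k" for P
    using ij(4) by (metis UNIV_I insertE singletonD)
  have "(lborel :: (real^3) measure) = distr lborel borel ?T"
  proof (rule lborel_eqI)
    fix l u :: "real^3" assume lu: "\<And>b. b \<in> Basis \<Longrightarrow> l \<bullet> b \<le> u \<bullet> b"
    have le: "l $ m \<le> u $ m" for m
      using lu[of "axis m 1"] by (simp add: inner_axis)
    have "?T -` box l u = (({l $ i <..< u $ i} \<times> {l $ j <..< u $ j}) \<times> {l $ k <..< u $ k})"
      using ij(1-3) by (auto simp: mem_box_cart all3 coords_def)
    then have "emeasure (distr lborel borel ?T) (box l u) =
        emeasure (lborel \<Otimes>\<^sub>M lborel) (({l $ i <..< u $ i} \<times> {l $ j <..< u $ j}) \<times> {l $ k <..< u $ k})"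
      by (subst emeasure_distr) (auto simp: lborel_prod)
    also have "\<dots> = emeasure (lborel \<Otimes>\<^sub>M lborel) ({l $ i <..< u $ i} \<times> {l $ j <..< u $ j}) * ennreal (u $ k - l $ k)"
      using le by (subst lborel.emeasure_pair_measure_Times)
        (auto simp: lborel_prod intro!: borel_open open_Times)
    also have "\<dots> = ennreal (u $ i - l $ i) * ennreal (u $ j - l $ j) * ennreal (u $ k - l $ k)"
      using le by (subst lborel.emeasure_pair_measure_Times) auto
    also have "\<dots> = ennreal (\<Prod>m\<in>UNIV. u $ m - l $ m)"
    proof -
      have "(\<Prod>m\<in>UNIV. u $ m - l $ m) = (u $ i - l $ i) * (u $ j - l $ j) * (u $ k - l $ k)"
        by (subst ij(4)) (use ij(1-3) in simp)
      then show ?thesis using le by (simp add: ennreal_mult)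
    qed
    also have "(\<Prod>m\<in>UNIV. u $ m - l $ m) = (\<Prod>b\<in>Basis. (u - l) \<bullet> b)"
      by (simp add: Basis_vec_def UNION_singleton_eq_range prod.reindex inj_on_def axis_eq_axis inner_axis)
    finally show "emeasure (distr lborel borel ?T) (box l u) = (\<Prod>b\<in>Basis. (u - l) \<bullet> b)" .
  qed simp
  then have "(\<integral>\<^sup>+x. F x \<partial>lborel) = (\<integral>\<^sup>+x. F x \<partial>distr lborel borel ?T)" by simp
  also have "\<dots> = (\<integral>\<^sup>+x. F (?T x) \<partial>lborel)" by (subst nn_integral_distr) auto
  also have "\<dots> = (\<integral>\<^sup>+x. F (?T x) \<partial>(lborel \<Otimes>\<^sub>M lborel))" by (simp add: lborel_prod)
  also have "\<dots> = (\<integral>\<^sup>+p. \<integral>\<^sup>+t. F (?T (p, t)) \<partial>lborel \<partial>lborel)"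
    by (rule lborel.nn_integral_fst[symmetric]) measurable
  finally show ?thesis by simp
qed

section \<open>The Sobolev inequality\<close>

text \<open>
  The fundamental theorem of calculus for \<open>w^4\<close>, started at a point where \<open>w\<close> is small. The added \<open>(w s)\<^sup>2\<close>
  provides such a point: if the integral is finite, then \<open>w\<^sup>2\<close> cannot stay above a positive constant on the
  whole line. For square integrable functions it takes the place of a decay condition at infinity.
\<close>

lemma fourth_power_le_line_integral:
  fixes w w' :: "real \<Rightarrow> real"
  assumes D: "\<And>t. (w has_real_derivative w' t) (at t)" and c: "continuous_on UNIV w'"
  shows "ennreal (w t ^ 4) \<le> (\<integral>\<^sup>+s. ennreal (4 * \<bar>w s\<bar> ^ 3 * \<bar>w' s\<bar> + (w s)\<^sup>2) \<partial>lborel)"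
    (is "_ \<le> ?I")
proof (cases "?I = \<infinity>")
  case False
  then obtain r where r: "?I = ennreal r" "0 \<le> r" by (cases ?I) auto
  have cw: "continuous_on UNIV w" using D DERIV_isCont by (auto intro!: continuous_at_imp_continuous_on)
  have [measurable]: "w \<in> borel_measurable borel" "w' \<in> borel_measurable borel"
    using cw c by (auto intro: borel_measurable_continuous_onI)
  have osc: "\<bar>w b ^ 4 - w a ^ 4\<bar> \<le> r" if "a \<le> b" for a b
  proof -
    let ?f = "\<lambda>s. 4 * w s ^ 3 * w' s"
    have "(\<integral>s. ?f s * indicator {a..b} s \<partial>lborel) = w b ^ 4 - w a ^ 4"
    proof (rule integral_FTC_Icc_real[OF that])
      show "((\<lambda>s. w s ^ 4) has_real_derivative ?f s) (at s)" for s
        by (auto intro!: derivative_eq_intros D simp: mult_ac)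
      show "isCont ?f s" for s
        using c cw by (intro continuous_intros) (auto simp: continuous_on_eq_continuous_at)
    qed
    then have "ennreal \<bar>w b ^ 4 - w a ^ 4\<bar> \<le> (\<integral>\<^sup>+s. ennreal \<bar>?f s * indicator {a..b} s\<bar> \<partial>lborel)"
      using integral_norm_bound_ennreal[of lborel "\<lambda>s. ?f s * indicator {a..b} s"]
        not_integrable_integral_eq[of lborel "\<lambda>s. ?f s * indicator {a..b} s"]
      by (cases "integrable lborel (\<lambda>s. ?f s * indicator {a..b} s)") auto
    also have "\<dots> \<le> ?I"
      by (intro nn_integral_mono ennreal_leI) (auto simp: indicator_def abs_mult power_abs)
    finally show ?thesis using r by simp
  qed
  have "w t ^ 4 \<le> r"
  proof (rule field_le_epsilon)
    fix e :: real assume e: "0 < e"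
    \<comment> \<open>The square root makes the starting value of \<open>w^4\<close> at most \<open>e\<close>.\<close>
    have "\<exists>s. (w s)\<^sup>2 < sqrt e"
    proof (rule ccontr)
      assume "\<not> ?thesis"
      then have "(\<integral>\<^sup>+s. ennreal (sqrt e) \<partial>(lborel :: real measure)) \<le> ?I"
        by (intro nn_integral_mono ennreal_leI) (auto simp: not_less add_increasing)
      then have "top \<le> ?I" using e by (simp add: ennreal_mult_top)
      then show False unfolding r(1) by (simp add: top_unique)
    qed
    then obtain s where "(w s)\<^sup>2 < sqrt e" ..
    then have "((w s)\<^sup>2)\<^sup>2 \<le> (sqrt e)\<^sup>2" by (intro power_mono) auto
    then have "w s ^ 4 \<le> e" using e by simp
    moreover have "\<bar>w t ^ 4 - w s ^ 4\<bar> \<le> r"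
      using osc[of s t] osc[of t s] by (cases "s \<le> t") (auto simp: abs_minus_commute)
    ultimately show "w t ^ 4 \<le> r + e" by linarith
  qed
  then show ?thesis using r by (simp add: ennreal_leI)
qed simp

text \<open>
  For each direction \<open>k\<close> the square root \<open>E i j k\<close> of the line integral of \<open>\<Phi> k\<close> bounds \<open>w\<^sup>2\<close> along the whole
  line. The product of the three bounds dominates \<open>w^6\<close>, and each of them is constant in its own direction, so
  the Loomis-Whitney inequality applies.
\<close>

lemma sixth_power_integral_le:
  fixes w :: "real^3 \<Rightarrow> real" and g :: "3 \<Rightarrow> real^3 \<Rightarrow> real"
  assumes w: "continuous_on UNIV w" and g: "\<And>i. continuous_on UNIV (g i)"
    and D: "\<And>i x. ((\<lambda>t. w (x + t *\<^sub>R axis i 1)) has_real_derivative g i x) (at 0)"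
  defines "\<Phi> \<equiv> \<lambda>i x. ennreal (4 * \<bar>w x\<bar> ^ 3 * \<bar>g i x\<bar> + (w x)\<^sup>2)"
  shows "(\<integral>\<^sup>+x. ennreal (w x ^ 6) \<partial>lborel)\<^sup>2 \<le> (\<Prod>i\<in>UNIV. \<integral>\<^sup>+x. \<Phi> i x \<partial>lborel)"
proof -
  have [measurable]: "w \<in> borel_measurable borel" "g i \<in> borel_measurable borel" for i
    using w g by (auto intro: borel_measurable_continuous_onI)
  have [measurable]: "\<Phi> i \<in> borel_measurable borel" for i unfolding \<Phi>_def by measurable
  have line: "ennreal (w (x + s *\<^sub>R axis i 1) ^ 4) \<le> (\<integral>\<^sup>+t. \<Phi> i (x + t *\<^sub>R axis i 1) \<partial>lborel)" for i x s
    unfolding \<Phi>_def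
  proof (rule fourth_power_le_line_integral)
    show "((\<lambda>t. w (x + t *\<^sub>R axis i 1)) has_real_derivative g i (x + t *\<^sub>R axis i 1)) (at t)" for t
      by (rule partial_line_derivative) (rule D)
    show "continuous_on UNIV (\<lambda>t. g i (x + t *\<^sub>R axis i 1))"
      by (rule continuous_on_compose2[OF g]) (auto intro!: continuous_on_add continuous_on_const
          continuous_on_scaleR continuous_on_id)
  qed
  define E where "E i j k p = esqrt (\<integral>\<^sup>+t. \<Phi> k (coords i j p t) \<partial>lborel)" for i j k p
  have [measurable]: "E i j k \<in> borel_measurable borel" for i j k
    unfolding E_def[abs_def] by measurable
  have E_ge: "ennreal ((w (coords i j p t))\<^sup>2) \<le> E i j k p"
    if "i \<noteq> k" "j \<noteq> k" "UNIV = {i, j, k}" for i j k p t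
  proof -
    have m: "m = i \<or> m = j \<or> m = k" for m using that(3) by blast
    have eq: "coords i j p t = coords i j p 0 + t *\<^sub>R axis k 1" for t
      unfolding vec_eq_iff using that(1,2) m by (auto simp: coords_def axis_def)
    have "ennreal (w (coords i j p t) ^ 4) \<le> (\<integral>\<^sup>+t. \<Phi> k (coords i j p t) \<partial>lborel)"
      using line[of "coords i j p 0" t k] by (simp only: eq[symmetric])
    then show ?thesis unfolding E_def by (intro le_esqrt) simp_all
  qed
  have E_int: "(\<integral>\<^sup>+p. (E i j k p)\<^sup>2 \<partial>lborel) = (\<integral>\<^sup>+x. \<Phi> k x \<partial>lborel)"
    if "i \<noteq> j" "i \<noteq> k" "j \<noteq> k" "UNIV = {i, j, k}" for i j k
    unfolding E_def esqrt_square using that by (intro nn_integral_coords[symmetric]) auto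
  have u: "UNIV = {1, 2, 3 :: 3}" "UNIV = {2, 3, 1 :: 3}" "UNIV = {1, 3, 2 :: 3}"
    using exhaust_3 by auto
  have "(\<integral>\<^sup>+x. ennreal (w x ^ 6) \<partial>lborel) = (\<integral>\<^sup>+p. \<integral>\<^sup>+c. ennreal (w (coords 1 2 p c) ^ 6) \<partial>lborel \<partial>lborel)"
    using u by (intro nn_integral_coords) auto
  also have "\<dots> \<le> (\<integral>\<^sup>+p. \<integral>\<^sup>+c. E 2 3 1 (snd p, c) * E 1 3 2 (fst p, c) * E 1 2 3 p \<partial>lborel \<partial>lborel)"
  proof (intro nn_integral_mono)
    fix p :: "real \<times> real" and c :: real
    let ?a = "(w (coords 1 2 p c))\<^sup>2"
    have "coords 1 2 p c = coords 2 3 (snd p, c) (fst p)" "coords 1 2 p c = coords 1 3 (fst p, c) (snd p)"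
      unfolding vec_eq_iff using exhaust_3 by (auto simp: coords_def)
    then have "ennreal ?a \<le> E 2 3 1 (snd p, c)" "ennreal ?a \<le> E 1 3 2 (fst p, c)" "ennreal ?a \<le> E 1 2 3 p"
      using E_ge[of 2 1 3 "(snd p, c)" "fst p"] E_ge[of 1 2 3 "(fst p, c)" "snd p"] E_ge[of 1 3 2 p c] u by simp_all
    then have "ennreal ?a * ennreal ?a * ennreal ?a \<le> E 2 3 1 (snd p, c) * E 1 3 2 (fst p, c) * E 1 2 3 p"
      by (intro mult_mono) auto
    moreover have "ennreal ?a * ennreal ?a * ennreal ?a = ennreal (w (coords 1 2 p c) ^ 6)"
      by (simp flip: ennreal_mult power_add)
    ultimately show "ennreal (w (coords 1 2 p c) ^ 6) \<le> E 2 3 1 (snd p, c) * E 1 3 2 (fst p, c) * E 1 2 3 p" by simp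
  qed
  finally have "(\<integral>\<^sup>+x. ennreal (w x ^ 6) \<partial>lborel)\<^sup>2 \<le>
      (\<integral>\<^sup>+p. \<integral>\<^sup>+c. E 2 3 1 (snd p, c) * E 1 3 2 (fst p, c) * E 1 2 3 p \<partial>lborel \<partial>lborel)\<^sup>2"
    by (intro power_mono) auto
  also have "\<dots> \<le> (\<integral>\<^sup>+p. (E 2 3 1 p)\<^sup>2 \<partial>lborel) * (\<integral>\<^sup>+p. (E 1 3 2 p)\<^sup>2 \<partial>lborel) * (\<integral>\<^sup>+p. (E 1 2 3 p)\<^sup>2 \<partial>lborel)"
    by (rule loomis_whitney) measurable
  also have "\<dots> = (\<Prod>i\<in>UNIV. \<integral>\<^sup>+x. \<Phi> i x \<partial>lborel)"
  proof -
    have "(\<integral>\<^sup>+p. (E 2 3 1 p)\<^sup>2 \<partial>lborel) = (\<integral>\<^sup>+x. \<Phi> 1 x \<partial>lborel)"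
      by (rule E_int[OF _ _ _ u(2)]) simp_all
    moreover have "(\<integral>\<^sup>+p. (E 1 3 2 p)\<^sup>2 \<partial>lborel) = (\<integral>\<^sup>+x. \<Phi> 2 x \<partial>lborel)"
      by (rule E_int[OF _ _ _ u(3)]) simp_all
    moreover have "(\<integral>\<^sup>+p. (E 1 2 3 p)\<^sup>2 \<partial>lborel) = (\<integral>\<^sup>+x. \<Phi> 3 x \<partial>lborel)"
      by (rule E_int[OF _ _ _ u(1)]) simp_all
    moreover have "(\<Prod>i\<in>UNIV. f i) = f 1 * f 2 * f 3" for f :: "3 \<Rightarrow> ennreal"
      unfolding UNIV_3 by (simp add: mult.assoc)
    ultimately show ?thesis by (simp only:)
  qed
  finally show ?thesis .
qed

text \<open>
  With \<open>s\<close> the \<open>L\<^sup>2\<close> norm of \<open>w^3\<close>, the Cauchy-Schwarz inequality bounds every factor of the previous lemma by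
  \<open>4 * N * s + Q\<close>, whence \<open>s^4 \<le> (4 * N * s + Q)^3\<close>. The power of \<open>s\<close> is larger on the left, so this bounds
  \<open>s\<close>, provided that \<open>s\<close> is finite; boundedness of \<open>w\<close> guarantees that. The bound is free of \<open>B\<close> and
  hence uniform along mollifications.
\<close>

lemma sobolev_bound:
  fixes w :: "real^3 \<Rightarrow> real" and g :: "3 \<Rightarrow> real^3 \<Rightarrow> real"
  assumes w: "continuous_on UNIV w" and g: "\<And>i. continuous_on UNIV (g i)"
    and D: "\<And>i x. ((\<lambda>t. w (x + t *\<^sub>R axis i 1)) has_real_derivative g i x) (at 0)"
    and B: "\<And>x. \<bar>w x\<bar> \<le> B"
    and Q: "(\<integral>\<^sup>+x. ennreal ((w x)\<^sup>2) \<partial>lborel) \<le> ennreal Q" "0 \<le> Q"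
    and N: "\<And>i. (\<integral>\<^sup>+x. ennreal ((g i x)\<^sup>2) \<partial>lborel) \<le> ennreal (N\<^sup>2)" "0 \<le> N"
  shows "(\<integral>\<^sup>+x. ennreal (w x ^ 6) \<partial>lborel) \<le> ennreal ((max 1 ((4 * N + Q) ^ 3))\<^sup>2)"
proof -
  have [measurable]: "w \<in> borel_measurable borel" "g i \<in> borel_measurable borel" for i
    using w g by (auto intro: borel_measurable_continuous_onI)
  let ?S = "\<integral>\<^sup>+x. ennreal (w x ^ 6) \<partial>lborel"
  \<comment> \<open>A priori finiteness of the integral.\<close>
  have "?S \<le> (\<integral>\<^sup>+x. ennreal (B ^ 4) * ennreal ((w x)\<^sup>2) \<partial>lborel)"
  proof (intro nn_integral_mono)
    fix x
    have "w x ^ 4 \<le> B ^ 4" using power_mono[OF B[of x], of 4] by simp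
    then have "w x ^ 4 * (w x)\<^sup>2 \<le> B ^ 4 * (w x)\<^sup>2" by (intro mult_right_mono) auto
    then show "ennreal (w x ^ 6) \<le> ennreal (B ^ 4) * ennreal ((w x)\<^sup>2)"
      by (simp flip: ennreal_mult power_add add: ennreal_leI)
  qed
  also have "\<dots> \<le> ennreal (B ^ 4) * ennreal Q"
    using Q by (subst nn_integral_cmult) (auto intro: mult_left_mono)
  also have "\<dots> < \<infinity>" by (simp flip: ennreal_mult')
  finally obtain S where S: "?S = ennreal S" "0 \<le> S" by (cases ?S) auto
  define s where "s = sqrt S"
  have s: "0 \<le> s" "s\<^sup>2 = S" using S by (auto simp: s_def)
  have \<Phi>: "(\<integral>\<^sup>+x. ennreal (4 * \<bar>w x\<bar> ^ 3 * \<bar>g i x\<bar> + (w x)\<^sup>2) \<partial>lborel) \<le> ennreal (4 * N * s + Q)" for i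
  proof -
    let ?J = "\<integral>\<^sup>+x. ennreal (\<bar>w x\<bar> ^ 3) * ennreal \<bar>g i x\<bar> \<partial>lborel"
    have "?J\<^sup>2 \<le> (\<integral>\<^sup>+x. (ennreal (\<bar>w x\<bar> ^ 3))\<^sup>2 \<partial>lborel) * (\<integral>\<^sup>+x. (ennreal \<bar>g i x\<bar>)\<^sup>2 \<partial>lborel)"
      by (rule Cauchy_Schwarz_nn_integral) measurable
    also have "\<dots> = ?S * (\<integral>\<^sup>+x. ennreal ((g i x)\<^sup>2) \<partial>lborel)"
      by (simp add: ennreal_power flip: power_mult)
    also have "\<dots> \<le> ennreal S * ennreal (N\<^sup>2)"
      unfolding S by (intro mult_left_mono N) simp
    also have "\<dots> = (ennreal (N * s))\<^sup>2"
      using s N(2) S(2) by (simp add: ennreal_power power_mult_distrib mult.commute flip: ennreal_mult)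
    finally have J: "?J \<le> ennreal (N * s)"
      by (rule ennreal_power2_le_imp_le) (use s N(2) in simp)
    have "(\<integral>\<^sup>+x. ennreal (4 * \<bar>w x\<bar> ^ 3 * \<bar>g i x\<bar> + (w x)\<^sup>2) \<partial>lborel) =
        (\<integral>\<^sup>+x. 4 * (ennreal (\<bar>w x\<bar> ^ 3) * ennreal \<bar>g i x\<bar>) + ennreal ((w x)\<^sup>2) \<partial>lborel)"
      by (intro nn_integral_cong) (simp add: ennreal_mult mult.assoc)
    also have "\<dots> = 4 * ?J + (\<integral>\<^sup>+x. ennreal ((w x)\<^sup>2) \<partial>lborel)"
      by (subst nn_integral_add) (auto simp: nn_integral_cmult)
    also have "\<dots> \<le> 4 * ennreal (N * s) + ennreal Q"
      by (intro add_mono mult_left_mono J Q) simp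
    also have "\<dots> = ennreal (4 * N * s + Q)"
      using N(2) s(1) Q(2) by (simp add: ennreal_mult mult.assoc)
    finally show ?thesis .
  qed
  have "?S\<^sup>2 \<le> (\<Prod>i\<in>UNIV. \<integral>\<^sup>+x. ennreal (4 * \<bar>w x\<bar> ^ 3 * \<bar>g i x\<bar> + (w x)\<^sup>2) \<partial>lborel)"
    by (rule sixth_power_integral_le[OF w g D])
  also have "\<dots> \<le> ennreal (4 * N * s + Q) * (ennreal (4 * N * s + Q) * ennreal (4 * N * s + Q))"
    unfolding UNIV_3 by (simp del: ennreal_plus) (intro mult_mono \<Phi>, auto)
  also have "\<dots> = ennreal (4 * N * s + Q) ^ 3" by (simp add: eval_nat_numeral)
  also have "\<dots> = ennreal ((4 * N * s + Q) ^ 3)"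
    using N(2) s(1) Q(2) by (simp add: ennreal_power del: ennreal_plus)
  finally have "ennreal (S\<^sup>2) \<le> ennreal ((4 * N * s + Q) ^ 3)" unfolding S by (simp add: ennreal_power S)
  then have *: "s ^ 4 \<le> (4 * N * s + Q) ^ 3"
    using N(2) s Q(2) by (simp add: power2_eq_square power4_eq_xxxx ennreal_le_iff flip: s(2))
  have "s \<le> max 1 ((4 * N + Q) ^ 3)"
  proof (cases "s \<le> 1")
    case False
    have "4 * N * s + Q \<le> s * (4 * N + Q)"
      using False Q(2) mult_right_mono[of 1 s Q] by (simp add: algebra_simps)
    then have "(4 * N * s + Q) ^ 3 \<le> (s * (4 * N + Q)) ^ 3"
      using N(2) s(1) Q(2) by (intro power_mono) auto
    with * have "s ^ 3 * s \<le> s ^ 3 * (4 * N + Q) ^ 3" by (simp add: power_mult_distrib eval_nat_numeral mult_ac)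
    then have "s \<le> (4 * N + Q) ^ 3" using False by (simp add: mult_le_cancel_left)
    then show ?thesis by simp
  qed simp
  then have "s\<^sup>2 \<le> (max 1 ((4 * N + Q) ^ 3))\<^sup>2" using s(1) by (intro power_mono)
  then show ?thesis unfolding S using s by (simp add: ennreal_leI)
qed

section \<open>Mollification of functions in H1\<close>

lemma Lp_numeral:
  "Lp (numeral k) f \<longleftrightarrow> f \<in> borel_measurable lebesgue \<and> integrable lebesgue (\<lambda>x. norm (f x) ^ numeral k)"
  by (simp add: Lp_def powr_numeral)

lemma Fatou_bound:
  fixes f :: "nat \<Rightarrow> 'a \<Rightarrow> real"
  assumes [measurable]: "\<And>n. f n \<in> borel_measurable M"
    and lim: "AE x in M. (\<lambda>n. f n x) \<longlonglongrightarrow> F x"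
    and le: "\<And>n. (\<integral>\<^sup>+x. ennreal (f n x) \<partial>M) \<le> C"
  shows "(\<integral>\<^sup>+x. ennreal (F x) \<partial>M) \<le> C"
proof -
  have "(\<integral>\<^sup>+x. ennreal (F x) \<partial>M) = (\<integral>\<^sup>+x. liminf (\<lambda>n. ennreal (f n x)) \<partial>M)"
  proof (rule nn_integral_cong_AE)
    show "AE x in M. ennreal (F x) = liminf (\<lambda>n. ennreal (f n x))"
      using lim
      by eventually_elim (intro lim_imp_Liminf[symmetric] tendsto_ennrealI, auto)
  qed
  also have "\<dots> \<le> liminf (\<lambda>n. \<integral>\<^sup>+x. ennreal (f n x) \<partial>M)"
    by (rule nn_integral_liminf) measurable
  also have "\<dots> \<le> limsup (\<lambda>n. \<integral>\<^sup>+x. ennreal (f n x) \<partial>M)"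
    by (rule Liminf_le_Limsup) simp
  also have "\<dots> \<le> C"
    by (rule Limsup_bounded) (simp add: le)
  finally show ?thesis .
qed

lemma H1_regularity:
  assumes "u \<in> H1"
  shows "u \<in> borel_measurable lebesgue" "integrable lebesgue (\<lambda>x. (u x)\<^sup>2)"
    "has_weak_gradient u (weak_grad u)" "weak_grad u \<in> borel_measurable lebesgue"
    "integrable lebesgue (\<lambda>x. (norm (weak_grad u x))\<^sup>2)"
  using assms by (auto simp: H1_def Lp_numeral intro: weak_grad_weak_gradient)

lemma H1_mollification:
  assumes u: "u \<in> H1"
  defines "w \<equiv> \<lambda>n. correlate (mollifier (1 / real (Suc n))) u"
    and "g \<equiv> \<lambda>n i. correlate (mollifier (1 / real (Suc n))) (\<lambda>y. weak_grad u y $ i)"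
  shows "continuous_on UNIV (w n)" "continuous_on UNIV (g n i)"
    "((\<lambda>t. w n (x + t *\<^sub>R axis i 1)) has_real_derivative g n i x) (at 0)"
    "\<exists>B. \<forall>x. \<bar>w n x\<bar> \<le> B"
    "(\<integral>\<^sup>+x. ennreal ((w n x)\<^sup>2) \<partial>lborel) \<le> ennreal (\<integral>x. (u x)\<^sup>2 \<partial>lebesgue)"
    "(\<integral>\<^sup>+x. ennreal (\<Sum>i\<in>UNIV. (g n i x)\<^sup>2) \<partial>lborel) \<le> ennreal (\<integral>x. (norm (weak_grad u x))\<^sup>2 \<partial>lebesgue)"
    "AE x in lebesgue. (\<lambda>n. w n x) \<longlonglongrightarrow> u x"
proof -
  note [measurable] = H1_regularity(1,4)[OF u]
  have h: "0 < 1 / real (Suc n)" by simp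
  have test: "test_function (mollifier (1 / real (Suc n)))" by (rule test_function_mollifier[OF h])
  have loc: "locally_integrable u" "locally_integrable (\<lambda>y. weak_grad u y $ i)" for i
    using H1_regularity(3)[OF u] by (auto simp: has_weak_gradient_def intro: locally_integrable_component)
  note [measurable] = locally_integrable_measurable[OF loc(2)]
  show "continuous_on UNIV (w n)" "continuous_on UNIV (g n i)"
    unfolding w_def g_def by (intro continuous_correlate test loc)+
  then have [measurable]: "g n i \<in> borel_measurable borel" for i
    unfolding g_def by (intro borel_measurable_continuous_onI continuous_correlate test loc)
  show "((\<lambda>t. w n (x + t *\<^sub>R axis i 1)) has_real_derivative g n i x) (at 0)"
    unfolding w_def g_def by (intro correlate_has_partial_weak_gradient test H1_regularity(3)[OF u])
  have u2: "(\<integral>\<^sup>+x. ennreal ((u x)\<^sup>2) \<partial>lebesgue) = ennreal (\<integral>x. (u x)\<^sup>2 \<partial>lebesgue)"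
    by (intro nn_integral_eq_integral H1_regularity(2)[OF u]) simp
  show "\<exists>B. \<forall>x. \<bar>w n x\<bar> \<le> B"
    unfolding w_def by (rule mollification_bounded[OF h H1_regularity(1)[OF u]]) (auto simp: u2)
  show "(\<integral>\<^sup>+x. ennreal ((w n x)\<^sup>2) \<partial>lborel) \<le> ennreal (\<integral>x. (u x)\<^sup>2 \<partial>lebesgue)"
    using mollification_L2_le[OF h H1_regularity(1)[OF u]] unfolding w_def u2[symmetric]
    by (simp add: nn_integral_completion)
  show "AE x in lebesgue. (\<lambda>n. w n x) \<longlonglongrightarrow> u x"
    unfolding w_def by (rule mollification_AE_tendsto[OF loc(1)])
  have "(\<integral>\<^sup>+x. ennreal (\<Sum>i\<in>UNIV. (g n i x)\<^sup>2) \<partial>lborel) = (\<Sum>i\<in>UNIV. \<integral>\<^sup>+x. ennreal ((g n i x)\<^sup>2) \<partial>lborel)"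
    by (subst nn_integral_sum[symmetric]) (auto simp: sum_ennreal)
  also have "\<dots> \<le> (\<Sum>i\<in>UNIV. \<integral>\<^sup>+x. ennreal ((weak_grad u x $ i)\<^sup>2) \<partial>lborel)"
    unfolding g_def by (intro sum_mono mollification_L2_le h) measurable
  also have "\<dots> = (\<Sum>i\<in>UNIV. \<integral>\<^sup>+x. ennreal ((weak_grad u x $ i)\<^sup>2) \<partial>lebesgue)"
    by (simp add: nn_integral_completion)
  also have "\<dots> = (\<integral>\<^sup>+x. ennreal (\<Sum>i\<in>UNIV. (weak_grad u x $ i)\<^sup>2) \<partial>lebesgue)"
    by (subst nn_integral_sum[symmetric]) (auto simp: sum_ennreal)
  also have "\<dots> = (\<integral>\<^sup>+x. ennreal ((norm (weak_grad u x))\<^sup>2) \<partial>lebesgue)"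
    by (simp add: norm_vec_def L2_set_def sum_nonneg)
  also have "\<dots> = ennreal (\<integral>x. (norm (weak_grad u x))\<^sup>2 \<partial>lebesgue)"
    by (intro nn_integral_eq_integral H1_regularity(5)[OF u]) simp
  finally show "(\<integral>\<^sup>+x. ennreal (\<Sum>i\<in>UNIV. (g n i x)\<^sup>2) \<partial>lborel) \<le> ennreal (\<integral>x. (norm (weak_grad u x))\<^sup>2 \<partial>lebesgue)" .
qed

text \<open>
  The quantities \<open>Q\<close> and \<open>N\<close> of the Sobolev bound can be chosen independently of the mollification parameter.
\<close>

lemma H1_mollification_L6:
  assumes u: "u \<in> H1"
  shows "\<exists>C. \<forall>n. (\<integral>\<^sup>+x. ennreal (correlate (mollifier (1 / real (Suc n))) u x ^ 6) \<partial>lborel) \<le> ennreal C"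
proof -
  define Q where "Q = (\<integral>x. (u x)\<^sup>2 \<partial>lebesgue)"
  define N where "N = sqrt (\<integral>x. (norm (weak_grad u x))\<^sup>2 \<partial>lebesgue)"
  have QN: "0 \<le> Q" "0 \<le> N" "(\<integral>x. (norm (weak_grad u x))\<^sup>2 \<partial>lebesgue) = N\<^sup>2"
    unfolding Q_def N_def by simp_all
  note m = H1_mollification[OF u]
  have "(\<integral>\<^sup>+x. ennreal (correlate (mollifier (1 / real (Suc n))) u x ^ 6) \<partial>lborel)
      \<le> ennreal ((max 1 ((4 * N + Q) ^ 3))\<^sup>2)" for n
  proof -
    obtain B where B: "\<And>x. \<bar>correlate (mollifier (1 / real (Suc n))) u x\<bar> \<le> B" using m(4) by blast
    have g2: "(\<integral>\<^sup>+x. ennreal ((correlate (mollifier (1 / real (Suc n))) (\<lambda>y. weak_grad u y $ i) x)\<^sup>2) \<partial>lborel)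
        \<le> ennreal (N\<^sup>2)" for i
      unfolding QN(3)[symmetric]
      by (rule order_trans[OF nn_integral_mono m(6)[where n = n]])
        (intro ennreal_leI member_le_sum, auto)
    show ?thesis
      by (rule sobolev_bound[OF m(1,2,3) B]) (use m(5) g2 QN in \<open>auto simp: Q_def\<close>)
  qed
  then show ?thesis by blast
qed

lemma H1_imp_L6:
  assumes u: "u \<in> H1"
  shows "integrable lebesgue (\<lambda>x. u x ^ 6)"
proof -
  note [measurable] = H1_regularity(1)[OF u]
  note m = H1_mollification[OF u]
  obtain C where C: "\<And>n. (\<integral>\<^sup>+x. ennreal (correlate (mollifier (1 / real (Suc n))) u x ^ 6) \<partial>lborel) \<le> ennreal C"
    using H1_mollification_L6[OF u] by blast
  have [measurable]: "correlate (mollifier (1 / real (Suc n))) u \<in> borel_measurable lebesgue" for n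
    by (intro borel_imp_lebesgue_measurable borel_measurable_continuous_onI m(1))
  have "(\<integral>\<^sup>+x. ennreal (u x ^ 6) \<partial>lebesgue) \<le> ennreal C"
  proof (rule Fatou_bound[where f = "\<lambda>n x. correlate (mollifier (1 / real (Suc n))) u x ^ 6"])
    show "AE x in lebesgue. (\<lambda>n. correlate (mollifier (1 / real (Suc n))) u x ^ 6) \<longlonglongrightarrow> u x ^ 6"
      using m(7) by eventually_elim (rule tendsto_power)
    show "(\<lambda>x. correlate (mollifier (1 / real (Suc n))) u x ^ 6) \<in> borel_measurable lebesgue" for n
      by measurable
  qed (use C in \<open>auto simp: nn_integral_completion\<close>)
  also have "\<dots> < \<infinity>" by simp
  finally show ?thesis by (intro integrableI_nonneg) auto
qed

section \<open>Testing the Poisson equation with the modulus\<close>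

text \<open>
  By uniqueness of weak gradients, \<open>weak_grad v\<close> is almost everywhere the vector of the partial derivatives.
\<close>

lemma D12_partials:
  fixes v :: "real^3 \<Rightarrow> real" and g :: "3 \<Rightarrow> real^3 \<Rightarrow> real"
  assumes v: "continuous_on UNIV v" and g: "\<And>i. continuous_on UNIV (g i)"
    and D: "\<And>i x. ((\<lambda>t. v (x + t *\<^sub>R axis i 1)) has_real_derivative g i x) (at 0)"
    and fin: "(\<integral>\<^sup>+x. ennreal (v x ^ 6) \<partial>lborel) < \<infinity>"
    and fin': "(\<integral>\<^sup>+x. ennreal (\<Sum>i\<in>UNIV. (g i x)\<^sup>2) \<partial>lborel) < \<infinity>"
  shows "v \<in> D12"
    and "ennreal (\<integral>x. (norm (weak_grad v x))\<^sup>2 \<partial>lebesgue) = (\<integral>\<^sup>+x. ennreal (\<Sum>i\<in>UNIV. (g i x)\<^sup>2) \<partial>lborel)"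
proof -
  have wg: "has_weak_gradient v (\<lambda>x. \<chi> i. g i x)"
    by (rule has_weak_gradient_partials[OF v g D])
  then have wd: "weakly_differentiable v" by (auto simp: weakly_differentiable_def)
  have [measurable]: "v \<in> borel_measurable lebesgue" "weak_grad v \<in> borel_measurable lebesgue"
    using v weak_grad_weak_gradient[OF wd]
    by (auto simp: has_weak_gradient_def intro: locally_integrable_measurable)
  have eq: "(\<integral>\<^sup>+x. ennreal ((norm (weak_grad v x))\<^sup>2) \<partial>lebesgue) = (\<integral>\<^sup>+x. ennreal (\<Sum>i\<in>UNIV. (g i x)\<^sup>2) \<partial>lebesgue)"
  proof (rule nn_integral_cong_AE)
    show "AE x in lebesgue. ennreal ((norm (weak_grad v x))\<^sup>2) = ennreal (\<Sum>i\<in>UNIV. (g i x)\<^sup>2)"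
      using weak_grad_AE_eq[OF wg] by eventually_elim (simp add: norm_vec_def L2_set_def sum_nonneg)
  qed
  have int: "integrable lebesgue (\<lambda>x. (norm (weak_grad v x))\<^sup>2)"
    using fin' eq by (intro integrableI_nonneg) (auto simp: nn_integral_completion)
  moreover have "integrable lebesgue (\<lambda>x. v x ^ 6)"
    using fin by (intro integrableI_nonneg) (auto simp: nn_integral_completion)
  ultimately show "v \<in> D12" using wd by (simp add: D12_def Lp_numeral)
  show "ennreal (\<integral>x. (norm (weak_grad v x))\<^sup>2 \<partial>lebesgue) = (\<integral>\<^sup>+x. ennreal (\<Sum>i\<in>UNIV. (g i x)\<^sup>2) \<partial>lborel)"
    using eq nn_integral_eq_integral[OF int] by (simp add: nn_integral_completion)
qed

text \<open>
  The larger of \<open>\<bar>a\<bar>\<close> and \<open>\<bar>b\<bar>\<close> shows that \<open>\<bar>a\<bar>^5 * \<bar>b\<bar> \<le> a^6 + b^6\<close>.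
\<close>

lemma integrable_fifth_power_mult:
  fixes u v :: "real^3 \<Rightarrow> real"
  assumes [measurable]: "u \<in> borel_measurable lebesgue" "v \<in> borel_measurable lebesgue"
    and "integrable lebesgue (\<lambda>x. u x ^ 6)" "integrable lebesgue (\<lambda>x. v x ^ 6)"
  shows "integrable lebesgue (\<lambda>x. \<bar>u x\<bar> ^ 5 * v x)"
proof (rule Bochner_Integration.integrable_bound)
  show "integrable lebesgue (\<lambda>x. u x ^ 6 + v x ^ 6)" using assms by simp
  have "\<bar>a\<bar> ^ 5 * \<bar>b\<bar> \<le> a ^ 6 + b ^ 6" for a b :: real
  proof (cases "\<bar>a\<bar> \<le> \<bar>b\<bar>")
    case True
    then have "\<bar>a\<bar> ^ 5 * \<bar>b\<bar> \<le> \<bar>b\<bar> ^ 5 * \<bar>b\<bar>" by (intro mult_right_mono power_mono) auto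
    also have "\<dots> = b ^ 6" by (simp flip: power_Suc2 add: power_even_abs)
    finally show ?thesis by (simp add: add_increasing)
  next
    case False
    then have "\<bar>a\<bar> ^ 5 * \<bar>b\<bar> \<le> \<bar>a\<bar> ^ 5 * \<bar>a\<bar>" by (intro mult_left_mono) auto
    also have "\<dots> = a ^ 6" by (simp flip: power_Suc2 add: power_even_abs)
    finally show ?thesis by (simp add: add_increasing2)
  qed
  then show "AE x in lebesgue. norm (\<bar>u x\<bar> ^ 5 * v x) \<le> norm (u x ^ 6 + v x ^ 6)"
    by (simp add: abs_mult power_abs)
qed measurable


lemma inner_le_sum_of_squares: "2 * c * (x \<bullet> y) \<le> c\<^sup>2 * (norm x)\<^sup>2 + (norm y)\<^sup>2"
  for x y :: "'a::real_inner"
proof -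
  have "0 \<le> (c *\<^sub>R x - y) \<bullet> (c *\<^sub>R x - y)" by simp
  also have "\<dots> = c\<^sup>2 * (norm x)\<^sup>2 - 2 * c * (x \<bullet> y) + (norm y)\<^sup>2"
    unfolding power2_norm_eq_inner
    by (simp add: inner_diff_left inner_diff_right inner_commute power2_eq_square algebra_simps)
  finally show ?thesis by simp
qed

text \<open>
  Formally this is the Poisson equation tested with \<open>\<bar>u\<bar>\<close>, followed by \<open>2 * c * (x \<bullet> y) \<le> c\<^sup>2 * \<bar>x\<bar>\<^sup>2 + \<bar>y\<bar>\<^sup>2\<close>. The admissible
  test functions \<open>v n\<close> are smoothed moduli of the mollifications \<open>w n\<close>; they satisfy \<open>0 \<le> v n \<le> \<bar>w n\<bar>\<close> and
  \<open>\<bar>\<nabla>(v n)\<bar> \<le> \<bar>\<nabla>(w n)\<bar>\<close>, and Fatou's lemma gives the claim for their limit \<open>\<bar>u\<bar>\<close>.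
\<close>

lemma poisson_L6_estimate:
  assumes u: "u \<in> H1" and \<phi>: "weak_poisson_solution (\<lambda>x. \<bar>u x\<bar> ^ 5) \<phi>" and c: "0 \<le> c"
  shows "2 * c * (\<integral>x. u x ^ 6 \<partial>lebesgue) \<le>
    c\<^sup>2 * (\<integral>x. (norm (weak_grad \<phi> x))\<^sup>2 \<partial>lebesgue) + (\<integral>x. (norm (weak_grad u x))\<^sup>2 \<partial>lebesgue)"
proof -
  define A where "A = (\<integral>x. (norm (weak_grad u x))\<^sup>2 \<partial>lebesgue)"
  define P where "P = (\<integral>x. (norm (weak_grad \<phi> x))\<^sup>2 \<partial>lebesgue)"
  have AP: "0 \<le> A" "0 \<le> P" by (simp_all add: A_def P_def)
  define \<delta> where "\<delta> n = 1 / real (Suc n)" for n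
  define w where "w n = correlate (mollifier (1 / real (Suc n))) u" for n
  define g where "g n i = correlate (mollifier (1 / real (Suc n))) (\<lambda>y. weak_grad u y $ i)" for n i
  define s where "s n x = sqrt ((w n x)\<^sup>2 + (\<delta> n)\<^sup>2)" for n x
  define v where "v n x = s n x - \<delta> n" for n x
  define gv where "gv n i x = w n x * g n i x / s n x" for n i x
  note m = H1_mollification[OF u, folded w_def g_def]
  have \<delta>: "0 < \<delta> n" for n by (simp add: \<delta>_def)
  have s_pos: "0 < s n x" for n x unfolding s_def using \<delta>[of n] by (simp add: add_nonneg_pos)
  have s_sq: "(s n x)\<^sup>2 = (w n x)\<^sup>2 + (\<delta> n)\<^sup>2" for n x unfolding s_def by simp
  have cs: "continuous_on UNIV (s n)" for n
    unfolding s_def[abs_def]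
    by (intro continuous_on_real_sqrt continuous_on_add continuous_on_power m(1) continuous_on_const)
  have cv: "continuous_on UNIV (v n)" for n
    unfolding v_def[abs_def] by (intro continuous_on_diff cs continuous_on_const)
  have cgv: "continuous_on UNIV (gv n i)" for n i
    unfolding gv_def[abs_def]
    by (intro continuous_on_divide continuous_on_mult m(1) m(2) cs) (simp add: s_pos less_imp_neq[symmetric])
  have Dv: "((\<lambda>t. v n (x + t *\<^sub>R axis i 1)) has_real_derivative gv n i x) (at 0)" for n i x
  proof -
    let ?a = "\<lambda>t. w n (x + t *\<^sub>R axis i 1)"
    have "((\<lambda>t. (?a t)\<^sup>2 + (\<delta> n)\<^sup>2) has_real_derivative 2 * w n x * g n i x) (at 0)"
      using m(3)[of n x i] by (auto intro!: derivative_eq_intros)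
    moreover have "0 < (?a 0)\<^sup>2 + (\<delta> n)\<^sup>2" using \<delta>[of n] by (simp add: add_nonneg_pos)
    ultimately have sqrt_D: "((\<lambda>t. sqrt ((?a t)\<^sup>2 + (\<delta> n)\<^sup>2)) has_real_derivative
        inverse (sqrt ((?a 0)\<^sup>2 + (\<delta> n)\<^sup>2)) / 2 * (2 * w n x * g n i x)) (at 0)"
      by (rule DERIV_chain2[OF DERIV_real_sqrt, rotated])
    have gv_eq: "gv n i x = inverse (sqrt ((?a 0)\<^sup>2 + (\<delta> n)\<^sup>2)) / 2 * (2 * w n x * g n i x) - 0"
      by (simp add: gv_def s_def inverse_eq_divide)
    show ?thesis unfolding v_def s_def gv_eq by (intro DERIV_diff sqrt_D DERIV_const)
  qed
  have v_nonneg: "0 \<le> v n x" and v_le: "v n x \<le> \<bar>w n x\<bar>" for n x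
  proof -
    have "\<delta> n \<le> s n x" unfolding s_def by (rule real_le_rsqrt) simp
    then show "0 \<le> v n x" by (simp add: v_def)
    have "s n x \<le> \<bar>w n x\<bar> + \<delta> n"
      unfolding s_def using \<delta>[of n] by (intro real_le_lsqrt) (auto simp: power2_sum)
    then show "v n x \<le> \<bar>w n x\<bar>" by (simp add: v_def)
  qed
  obtain C where C: "\<And>n. (\<integral>\<^sup>+x. ennreal (w n x ^ 6) \<partial>lborel) \<le> ennreal C"
    using H1_mollification_L6[OF u] unfolding w_def by blast
  have fin6: "(\<integral>\<^sup>+x. ennreal (v n x ^ 6) \<partial>lborel) < \<infinity>" for n
  proof -
    have "v n x ^ 6 \<le> w n x ^ 6" for x
      using power_mono[OF v_le v_nonneg, of n x 6] by (simp add: power_even_abs)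
    then have "(\<integral>\<^sup>+x. ennreal (v n x ^ 6) \<partial>lborel) \<le> (\<integral>\<^sup>+x. ennreal (w n x ^ 6) \<partial>lborel)"
      by (intro nn_integral_mono ennreal_leI)
    also have "\<dots> \<le> ennreal C" by (rule C)
    also have "\<dots> < \<infinity>" by simp
    finally show ?thesis .
  qed
  have grad_le: "(\<integral>\<^sup>+x. ennreal (\<Sum>i\<in>UNIV. (gv n i x)\<^sup>2) \<partial>lborel) \<le> ennreal A" for n
  proof -
    have "(gv n i x)\<^sup>2 \<le> (g n i x)\<^sup>2" for i x
    proof -
      have "(gv n i x)\<^sup>2 = (w n x)\<^sup>2 * (g n i x)\<^sup>2 / (s n x)\<^sup>2"
        by (simp add: gv_def power_mult_distrib power_divide)
      also have "\<dots> \<le> (g n i x)\<^sup>2"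
      proof -
        have "(w n x)\<^sup>2 * (g n i x)\<^sup>2 \<le> (g n i x)\<^sup>2 * (s n x)\<^sup>2"
          by (simp add: s_sq algebra_simps)
        moreover have "0 < (s n x)\<^sup>2" using s_pos[of n x] by simp
        ultimately show ?thesis by (simp only: pos_divide_le_eq)
      qed
      finally show ?thesis .
    qed
    then have "(\<integral>\<^sup>+x. ennreal (\<Sum>i\<in>UNIV. (gv n i x)\<^sup>2) \<partial>lborel) \<le> (\<integral>\<^sup>+x. ennreal (\<Sum>i\<in>UNIV. (g n i x)\<^sup>2) \<partial>lborel)"
      by (intro nn_integral_mono ennreal_leI sum_mono)
    also have "\<dots> \<le> ennreal A" unfolding A_def by (rule m(6))
    finally show ?thesis .
  qed
  then have fing: "(\<integral>\<^sup>+x. ennreal (\<Sum>i\<in>UNIV. (gv n i x)\<^sup>2) \<partial>lborel) < \<infinity>" for n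
    by (rule le_less_trans) simp
  have vD: "v n \<in> D12" for n
    by (rule D12_partials(1)[OF cv cgv Dv fin6 fing])
  have grad_v: "(\<integral>x. (norm (weak_grad (v n) x))\<^sup>2 \<partial>lebesgue) \<le> A" for n
  proof -
    have "ennreal (\<integral>x. (norm (weak_grad (v n) x))\<^sup>2 \<partial>lebesgue) \<le> ennreal A"
      unfolding D12_partials(2)[OF cv cgv Dv fin6 fing] by (rule grad_le)
    then show ?thesis using AP(1) by (simp only: ennreal_le_iff)
  qed
  have D12_int: "integrable lebesgue (\<lambda>x. (norm (weak_grad v x))\<^sup>2)" "integrable lebesgue (\<lambda>x. v x ^ 6)"
    "v \<in> borel_measurable lebesgue" if "v \<in> D12" for v
    using that by (auto simp: D12_def Lp_numeral power_even_abs)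
  have \<phi>D: "\<phi> \<in> D12" using \<phi> by (simp add: weak_poisson_solution_def)
  have key: "2 * c * (\<integral>x. \<bar>u x\<bar> ^ 5 * v n x \<partial>lebesgue) \<le> c\<^sup>2 * P + A" for n
  proof -
    have "2 * c * (\<integral>x. \<bar>u x\<bar> ^ 5 * v n x \<partial>lebesgue) = 2 * c * (\<integral>x. weak_grad \<phi> x \<bullet> weak_grad (v n) x \<partial>lebesgue)"
      using \<phi> vD[of n] by (simp add: weak_poisson_solution_def)
    also have "\<dots> = (\<integral>x. 2 * c * (weak_grad \<phi> x \<bullet> weak_grad (v n) x) \<partial>lebesgue)" by simp
    also have "\<dots> \<le> (\<integral>x. c\<^sup>2 * (norm (weak_grad \<phi> x))\<^sup>2 + (norm (weak_grad (v n) x))\<^sup>2 \<partial>lebesgue)"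
      by (rule integral_mono') (use D12_int(1)[OF \<phi>D] D12_int(1)[OF vD] inner_le_sum_of_squares in auto)
    also have "\<dots> = c\<^sup>2 * P + (\<integral>x. (norm (weak_grad (v n) x))\<^sup>2 \<partial>lebesgue)"
      using D12_int(1)[OF \<phi>D] D12_int(1)[OF vD[of n]] by (simp add: P_def)
    finally show ?thesis using grad_v[of n] by linarith
  qed
  note [measurable] = H1_regularity(1)[OF u] D12_int(3)[OF vD]
  have "(\<integral>\<^sup>+x. ennreal (2 * c * (\<bar>u x\<bar> ^ 5 * \<bar>u x\<bar>)) \<partial>lebesgue) \<le> ennreal (c\<^sup>2 * P + A)"
  proof (rule Fatou_bound[where f = "\<lambda>n x. 2 * c * (\<bar>u x\<bar> ^ 5 * v n x)"])
    show "(\<lambda>x. 2 * c * (\<bar>u x\<bar> ^ 5 * v n x)) \<in> borel_measurable lebesgue" for n by measurable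
    have \<delta>0: "\<delta> \<longlonglongrightarrow> 0" unfolding \<delta>_def[abs_def] by (rule LIMSEQ_Suc[OF lim_1_over_n])
    show "AE x in lebesgue. (\<lambda>n. 2 * c * (\<bar>u x\<bar> ^ 5 * v n x)) \<longlonglongrightarrow> 2 * c * (\<bar>u x\<bar> ^ 5 * \<bar>u x\<bar>)"
      using m(7)
    proof eventually_elim
      case (elim x)
      have "(\<lambda>n. v n x) \<longlonglongrightarrow> sqrt ((u x)\<^sup>2 + 0\<^sup>2) - 0"
        unfolding v_def s_def by (intro tendsto_intros elim \<delta>0)
      then show ?case by (intro tendsto_intros) simp
    qed
    show "(\<integral>\<^sup>+x. ennreal (2 * c * (\<bar>u x\<bar> ^ 5 * v n x)) \<partial>lebesgue) \<le> ennreal (c\<^sup>2 * P + A)" for n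
    proof -
      have "integrable lebesgue (\<lambda>x. \<bar>u x\<bar> ^ 5 * v n x)"
        using H1_regularity(1)[OF u] H1_imp_L6[OF u] D12_int[OF vD] by (intro integrable_fifth_power_mult)
      then have "(\<integral>\<^sup>+x. ennreal (2 * c * (\<bar>u x\<bar> ^ 5 * v n x)) \<partial>lebesgue) = ennreal (2 * c * (\<integral>x. \<bar>u x\<bar> ^ 5 * v n x \<partial>lebesgue))"
        using c v_nonneg by (subst nn_integral_eq_integral) auto
      then show ?thesis using key[of n] by (simp add: ennreal_leI)
    qed
  qed
  moreover have "\<bar>u x\<bar> ^ 5 * \<bar>u x\<bar> = u x ^ 6" for x
    using power_Suc2[of "\<bar>u x\<bar>" 5] by (simp add: power_even_abs)
  moreover have "(\<integral>\<^sup>+x. ennreal (2 * c * u x ^ 6) \<partial>lebesgue) = ennreal (2 * c * (\<integral>x. u x ^ 6 \<partial>lebesgue))"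
    using c H1_imp_L6[OF u] by (subst nn_integral_eq_integral) auto
  ultimately have "ennreal (2 * c * (\<integral>x. u x ^ 6 \<partial>lebesgue)) \<le> ennreal (c\<^sup>2 * P + A)" by simp
  then have "2 * c * (\<integral>x. u x ^ 6 \<partial>lebesgue) \<le> c\<^sup>2 * P + A"
    using AP by (subst (asm) ennreal_le_iff) auto
  then show ?thesis by (simp add: A_def P_def)
qed

section \<open>Nonexistence of nontrivial solutions\<close>

text \<open>
  Young's inequality for \<open>t\<^sup>2\<close> and \<open>t^6\<close> with the weights for which the exponents average to \<open>q\<close>.
\<close>

lemma powr_interpolation:
  fixes t q :: real
  assumes "2 < q" "q < 6" "0 \<le> t"
  shows "t powr q \<le> (6 - q) / 4 * t\<^sup>2 + (q - 2) / 4 * t ^ 6"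
proof (cases "t = 0")
  case False
  then have t: "0 < t" using assms by simp
  have "t powr q = (t powr 2) powr ((6 - q) / 4) * (t powr 6) powr ((q - 2) / 4)"
    by (simp add: powr_powr field_simps flip: powr_add)
  also have "\<dots> = (t\<^sup>2) powr ((6 - q) / 4) * (t ^ 6) powr ((q - 2) / 4)"
    using t by (simp add: powr_numeral)
  also have "\<dots> \<le> (6 - q) / 4 * t\<^sup>2 + (q - 2) / 4 * t ^ 6"
    using t assms by (intro Youngs_inequality_0) (auto simp: field_simps)
  finally show ?thesis .
qed simp

theorem theorem1p1:
  fixes q lam :: real
  assumes "2 < q" and "q < 6" and "lam \<ge> ((q + 2) / 8)^2"
  shows "\<forall>u :: real^3 \<Rightarrow> real. weak_solution q lam u \<longrightarrow> (AE x in lebesgue. u x = 0)"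
proof (intro allI impI)
  fix u :: "real^3 \<Rightarrow> real" assume "weak_solution q lam u"
  then obtain \<phi> where u: "u \<in> H1" and \<phi>: "weak_poisson_solution (\<lambda>x. \<bar>u x\<bar> ^ 5) \<phi>"
    and eq: "\<And>v. v \<in> H1 \<Longrightarrow>
          (\<integral>x. weak_grad u x \<bullet> weak_grad v x + u x * v x \<partial>lebesgue)
          + lam * (\<integral>x. \<phi> x * \<bar>u x\<bar> ^ 3 * u x * v x \<partial>lebesgue)
          - (\<integral>x. \<bar>u x\<bar> ^ 4 * u x * v x \<partial>lebesgue)
          - (\<integral>x. \<bar>u x\<bar> powr (q - 2) * u x * v x \<partial>lebesgue) = 0"
    unfolding weak_solution_def by blast
  define A where "A = (\<integral>x. (norm (weak_grad u x))\<^sup>2 \<partial>lebesgue)"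
  define B where "B = (\<integral>x. (u x)\<^sup>2 \<partial>lebesgue)"
  define C where "C = (\<integral>x. u x ^ 6 \<partial>lebesgue)"
  define P where "P = (\<integral>x. (norm (weak_grad \<phi> x))\<^sup>2 \<partial>lebesgue)"
  define E where "E = (\<integral>x. \<bar>u x\<bar> powr (q - 2) * u x * u x \<partial>lebesgue)"
  have L: "integrable lebesgue (\<lambda>x. (u x)\<^sup>2)" "integrable lebesgue (\<lambda>x. (norm (weak_grad u x))\<^sup>2)"
    "integrable lebesgue (\<lambda>x. u x ^ 6)"
    using H1_regularity[OF u] H1_imp_L6[OF u] by auto
  have 1: "(\<integral>x. weak_grad u x \<bullet> weak_grad u x + u x * u x \<partial>lebesgue) = A + B"
    using L by (simp add: A_def B_def power2_norm_eq_inner flip: power2_eq_square)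
  \<comment> \<open>The Poisson equation tested with its own solution.\<close>
  have 2: "(\<integral>x. \<phi> x * \<bar>u x\<bar> ^ 3 * u x * u x \<partial>lebesgue) = P"
  proof -
    have "P = (\<integral>x. \<bar>u x\<bar> ^ 5 * \<phi> x \<partial>lebesgue)"
      using \<phi> by (simp add: weak_poisson_solution_def P_def power2_norm_eq_inner)
    moreover have "\<phi> x * \<bar>u x\<bar> ^ 3 * u x * u x = \<bar>u x\<bar> ^ 5 * \<phi> x" for x
    proof -
      have "b ^ 3 * (b * b) = b ^ 5" for b :: real by (simp add: eval_nat_numeral)
      from this[of "\<bar>u x\<bar>"] have "\<bar>u x\<bar> ^ 3 * (u x * u x) = \<bar>u x\<bar> ^ 5"
        by (simp only: abs_mult_self_eq)
      then have "\<phi> x * (\<bar>u x\<bar> ^ 3 * (u x * u x)) = \<phi> x * \<bar>u x\<bar> ^ 5" by (rule arg_cong)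
      then show ?thesis by (simp only: mult.assoc) (simp only: mult.commute)
    qed
    ultimately show ?thesis by (simp only:)
  qed
  have 3: "(\<integral>x. \<bar>u x\<bar> ^ 4 * u x * u x \<partial>lebesgue) = C"
    unfolding C_def by (intro Bochner_Integration.integral_cong) (simp_all add: power_even_abs eval_nat_numeral)
  have 4: "E \<le> (6 - q) / 4 * B + (q - 2) / 4 * C"
  proof -
    have "E \<le> (\<integral>x. (6 - q) / 4 * (u x)\<^sup>2 + (q - 2) / 4 * u x ^ 6 \<partial>lebesgue)"
      unfolding E_def
    proof (rule integral_mono')
      fix x
      have "u x * u x = \<bar>u x\<bar> powr 2" by (simp add: powr_numeral power2_eq_square)
      moreover have "\<bar>u x\<bar> powr (q - 2) * \<bar>u x\<bar> powr 2 = \<bar>u x\<bar> powr q"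
        unfolding powr_add[symmetric] by simp
      ultimately have "\<bar>u x\<bar> powr (q - 2) * u x * u x = \<bar>u x\<bar> powr q"
        by (simp only: mult.assoc)
      then show "\<bar>u x\<bar> powr (q - 2) * u x * u x \<le> (6 - q) / 4 * (u x)\<^sup>2 + (q - 2) / 4 * u x ^ 6"
        using powr_interpolation[OF assms(1,2), of "\<bar>u x\<bar>"] by (simp add: power_even_abs)
    qed (use L assms in auto)
    then show ?thesis using L by (simp add: B_def C_def)
  qed
  \<comment> \<open>The choice for which \<open>2 * c\<close> is the total coefficient \<open>1 + (q - 2) / 4\<close> of \<open>C\<close> on the right-hand side.\<close>
  define c where "c = (q + 2) / 8"
  have c: "0 \<le> c" using assms by (simp add: c_def)
  have "A + B + lam * P - C - E = 0"
    using eq[OF u] unfolding 1 2 3 E_def .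
  moreover have "2 * c * C \<le> c\<^sup>2 * P + A"
    unfolding A_def C_def P_def by (rule poisson_L6_estimate[OF u \<phi> c])
  moreover have "c\<^sup>2 * P \<le> lam * P"
    using assms(3) by (intro mult_right_mono) (auto simp: c_def P_def)
  ultimately have "2 * c * C + B \<le> C + ((6 - q) / 4 * B + (q - 2) / 4 * C)" using 4 by linarith
  then have "(q - 2) * B \<le> 0" by (simp add: c_def field_simps)
  then have "B \<le> 0" using assms(1) by (simp add: mult_le_0_iff)
  then have "B = 0" unfolding B_def by (simp add: order_antisym)
  then have "AE x in lebesgue. (u x)\<^sup>2 = 0"
    unfolding B_def using L(1) by (subst (asm) integral_nonneg_eq_0_iff_AE) auto
  then show "AE x in lebesgue. u x = 0" by simp
qed

end
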